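(* Let $d\in\mathbb{N}$ be a spatial dimension, $c_1,c_2\in\mathbb{N}$ channel sizes, $K\subset\mathbb{R}^{c_1\times d}$ a compact set, $2k+1\ge 3$ an (odd) kernel size, and $\sigma:\mathbb{R}\to\mathbb{R}$ a non-affine continuous activation function such that there exist $\alpha\in\mathbb{R}$ and $\epsilon>0$ for which $\sigma$ is $C^1$ on the interval $(\alpha-\epsilon,\alpha+\epsilon)$ and $\sigma'(\alpha)\neq 0$. Then $$\overline{\Delta^{\sigma,d,2k+1}_{c_1,c_2,c_1+c_2+2}}=C(K,\mathbb{R}^{c_2\times d}).$$
   Context: $\mathbb{N}=\{1,2,\dots\}$, and $C(X,Y)$ is the set of continuous functions from $X$ to $Y$. An element $x\in\mathbb{R}^{c\times d}$ is written $x=(x^1,\dots,x^c)$ with channels $x^i=(x^i_1,\dots,x^i_d)\in\mathbb{R}^d$. $\boldsymbol{1}_d\in\mathbb{R}^d$ is the all-ones vector. Zero-padding convolution: for a kernel $w=(w_{-k},\dots,w_k)\in\mathbb{R}^{2k+1}$ (kernel size $2k+1$) and $x\in\mathbb{R}^d$, $w\circledast x\in\mathbb{R}^d$ is given by $(w\circledast x)_i=\sum_{j=-k}^{k}w_jx_{i-j}$ for $1\le i\le d$, with the convention $x_m=0$ for $m\notin\{1,\dots,d\}$. Convolutional layers: $\mathcal{L}^{d,2k+1}_{c,c'}$ is the set of maps $f=(f^1,\dots,f^{c'}):\mathbb{R}^{c\times d}\to\mathbb{R}^{c'\times d}$ of the form $f^i(x)=\sum_{j=1}^{c}w_{i,j}\circledast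 x^j+\delta_i\boldsymbol{1}_d$ with $w_{i,j}\in\mathbb{R}^{2k+1}$, $\delta_i\in\mathbb{R}$. Deep narrow CNNs: the activation $\sigma$ is applied componentwise. $\Delta^{\sigma,d,2k+1}_{c,c',l}$ is the set of all functions $C_N\circ\sigma\circ C_{N-1}\circ\cdots\circ\sigma\circ C_1:\mathbb{R}^{c\times d}\to\mathbb{R}^{c'\times d}$, where $N\in\mathbb{N}$ is arbitrary, $b_0=c$, $b_N=c'$, $b_1,\dots,b_{N-1}\in\{1,\dots,l\}$ are arbitrary channel sizes, and $C_i\in\mathcal{L}^{d,2k+1}_{b_{i-1},b_i}$. For a compact $K\subset\mathbb{R}^{c\times d}$ its elements are restricted to $K$, and the overline denotes closure in $C(K,\mathbb{R}^{c'\times d})$ with respect to the uniform norm $\|f\|_{\infty,K}=\sup_{x\in K}\|f(x)\|_\infty$. *)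

theory Defs
  imports "HOL-Analysis.Analysis"
begin

text \<open>
  Channel sizes vary inside a network, so elements of \<open>\<real>\<^bsup>c\<times>d\<^esup>\<close> are extensional functions on
  \<open>{1..c}\<close> with values in the extensional real functions on \<open>{1..d}\<close>: \<open>x i m\<close> is the \<open>m\<close>-th entry
  of the channel \<open>x i\<close>.
\<close>

type_synonym tensor = "nat \<Rightarrow> nat \<Rightarrow> real"

definition tensors :: "nat \<Rightarrow> nat \<Rightarrow> tensor set"
  where "tensors c d = {1..c} \<rightarrow>\<^sub>E ({1..d} \<rightarrow>\<^sub>E (UNIV :: real set))"

text \<open>
  The distance of the maximum norm.  The element \<open>0\<close> is inserted only to make the definition
  meaningful for \<open>c = 0\<close> or \<open>d = 0\<close>.
\<close>

definition tensor_dist :: "nat \<Rightarrow> nat \<Rightarrow> tensor \<Rightarrow> tensor \<Rightarrow> real"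
  where "tensor_dist c d x y =
    Max (insert 0 ((\<lambda>(i, m). \<bar>x i m - y i m\<bar>) ` ({1..c} \<times> {1..d})))"

definition tensor_metric :: "nat \<Rightarrow> nat \<Rightarrow> tensor metric"
  where "tensor_metric c d = metric (tensors c d, tensor_dist c d)"

lemma tensor_dist_le_iff:
  "tensor_dist c d x y \<le> r \<longleftrightarrow>
     0 \<le> r \<and> (\<forall>i\<in>{1..c}. \<forall>m\<in>{1..d}. \<bar>x i m - y i m\<bar> \<le> r)"
  unfolding tensor_dist_def by (subst Max_le_iff) auto

lemma tensor_dist_ge:
  "i \<in> {1..c} \<Longrightarrow> m \<in> {1..d} \<Longrightarrow> \<bar>x i m - y i m\<bar> \<le> tensor_dist c d x y"
  using tensor_dist_le_iff[of c d x y "tensor_dist c d x y"] by blast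

lemma tensor_dist_nonneg: "0 \<le> tensor_dist c d x y"
  using tensor_dist_le_iff[of c d x y "tensor_dist c d x y"] by blast

lemma Metric_space_tensors: "Metric_space (tensors c d) (tensor_dist c d)"
proof
  fix x y z :: tensor
  show "0 \<le> tensor_dist c d x y"
    by (rule tensor_dist_nonneg)
  show "tensor_dist c d x y = tensor_dist c d y x"
    by (simp add: tensor_dist_def abs_minus_commute)
  assume x: "x \<in> tensors c d" and y: "y \<in> tensors c d"
  show "tensor_dist c d x y = 0 \<longleftrightarrow> x = y"
  proof
    assume "tensor_dist c d x y = 0"
    then have eq: "x i m = y i m" if "i \<in> {1..c}" "m \<in> {1..d}" for i m
      using tensor_dist_ge[OF that, of x y] by simp
    show "x = y"
    proof (rule PiE_ext[OF x[unfolded tensors_def] y[unfolded tensors_def]])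
      fix i assume i: "i \<in> {1..c}"
      have "x i \<in> {1..d} \<rightarrow>\<^sub>E UNIV" "y i \<in> {1..d} \<rightarrow>\<^sub>E UNIV"
        using x y i unfolding tensors_def by blast+
      then show "x i = y i"
        by (rule PiE_ext) (use eq i in auto)
    qed
  next
    assume "x = y"
    then have "tensor_dist c d x y \<le> 0"
      by (simp add: tensor_dist_le_iff)
    with tensor_dist_nonneg[of c d x y] show "tensor_dist c d x y = 0"
      by simp
  qed
  show "tensor_dist c d x z \<le> tensor_dist c d x y + tensor_dist c d y z"
    unfolding tensor_dist_le_iff
  proof (intro conjI ballI)
    show "0 \<le> tensor_dist c d x y + tensor_dist c d y z"
      by (simp add: tensor_dist_nonneg)
    fix i m assume "i \<in> {1..c}" "m \<in> {1..d}"
    then show "\<bar>x i m - z i m\<bar> \<le> tensor_dist c d x y + tensor_dist c d y z"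
      using tensor_dist_ge[of i c m d x y] tensor_dist_ge[of i c m d y z] by linarith
  qed
qed

lemma mspace_tensor_metric [simp]: "mspace (tensor_metric c d) = tensors c d"
  by (simp add: tensor_metric_def Metric_space.mspace_metric[OF Metric_space_tensors])

lemma mdist_tensor_metric [simp]: "mdist (tensor_metric c d) = tensor_dist c d"
  by (simp add: tensor_metric_def Metric_space.mdist_metric[OF Metric_space_tensors])

text \<open>
  \<open>conv d k w x i\<close> is the \<open>i\<close>-th entry of the zero-padding convolution of \<open>x \<in> \<real>\<^bsup>d\<^esup>\<close> with the kernel
  \<open>(w (-k), \<dots>, w k)\<close>; only these values of \<open>w\<close> are used.
\<close>

definition conv :: "nat \<Rightarrow> nat \<Rightarrow> (int \<Rightarrow> real) \<Rightarrow> (nat \<Rightarrow> real) \<Rightarrow> nat \<Rightarrow> real"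
  where "conv d k w x = (\<lambda>i\<in>{1..d}. \<Sum>j = - int k..int k.
    w j * (if int i - j \<in> {1..int d} then x (nat (int i - j)) else 0))"

definition conv_layers :: "nat \<Rightarrow> nat \<Rightarrow> nat \<Rightarrow> nat \<Rightarrow> (tensor \<Rightarrow> tensor) set"
  where "conv_layers d k c c' = {f. \<exists>(w :: nat \<Rightarrow> nat \<Rightarrow> int \<Rightarrow> real) (\<delta> :: nat \<Rightarrow> real).
    f = (\<lambda>x. \<lambda>i\<in>{1..c'}. \<lambda>m\<in>{1..d}. (\<Sum>j = 1..c. conv d k (w i j) (x j) m) + \<delta> i)}"

definition act :: "(real \<Rightarrow> real) \<Rightarrow> nat \<Rightarrow> nat \<Rightarrow> tensor \<Rightarrow> tensor"
  where "act \<sigma> c d x = (\<lambda>i\<in>{1..c}. \<lambda>m\<in>{1..d}. \<sigma> (x i m))"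

text \<open>
  \<open>cnn \<sigma> d b C n\<close> has the \<open>n + 1\<close> layers \<open>C 1, \<dots>, C (n + 1)\<close>, and \<open>b i\<close> is the number of output
  channels of \<open>C i\<close>.
\<close>

primrec cnn :: "(real \<Rightarrow> real) \<Rightarrow> nat \<Rightarrow> (nat \<Rightarrow> nat) \<Rightarrow> (nat \<Rightarrow> tensor \<Rightarrow> tensor) \<Rightarrow>
    nat \<Rightarrow> tensor \<Rightarrow> tensor"
  where
    "cnn \<sigma> d b C 0 = C 1"
  | "cnn \<sigma> d b C (Suc n) = C (Suc (Suc n)) \<circ> act \<sigma> (b (Suc n)) d \<circ> cnn \<sigma> d b C n"

definition deep_narrow_cnns ::
    "(real \<Rightarrow> real) \<Rightarrow> nat \<Rightarrow> nat \<Rightarrow> nat \<Rightarrow> nat \<Rightarrow> nat \<Rightarrow> (tensor \<Rightarrow> tensor) set"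
  where "deep_narrow_cnns \<sigma> d k c c' l = {cnn \<sigma> d b C (N - 1) | N b C.
    1 \<le> N \<and> b 0 = c \<and> b N = c' \<and> (\<forall>i\<in>{1..<N}. b i \<in> {1..l}) \<and>
    (\<forall>i\<in>{1..N}. C i \<in> conv_layers d k (b (i - 1)) (b i))}"

text \<open>
  Functions on \<open>K\<close> are extensional, as in \<^const>\<open>cfunspace\<close>, whose distance is the supremum over \<open>K\<close>
  of the pointwise distances.
\<close>

definition cont_funs :: "nat \<Rightarrow> nat \<Rightarrow> nat \<Rightarrow> tensor set \<Rightarrow> (tensor \<Rightarrow> tensor) set"
  where "cont_funs d c c' K = {f \<in> extensional K.
    continuous_map (subtopology (mtopology_of (tensor_metric c d)) K)
      (mtopology_of (tensor_metric c' d)) f}"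

definition unif_metric :: "nat \<Rightarrow> nat \<Rightarrow> nat \<Rightarrow> tensor set \<Rightarrow> (tensor \<Rightarrow> tensor) metric"
  where "unif_metric d c c' K =
    cfunspace (subtopology (mtopology_of (tensor_metric c d)) K) (tensor_metric c' d)"

lemma mspace_unif_metric:
  assumes "compactin (mtopology_of (tensor_metric c d)) K"
  shows "mspace (unif_metric d c c' K) = cont_funs d c c' K"
proof -
  let ?T = "mtopology_of (tensor_metric c d)" and ?M = "tensor_metric c' d"
  have K: "topspace (subtopology ?T K) = K"
    using compactin_subset_topspace[OF assms] by auto
  have "Metric_space.mbounded (mspace ?M) (mdist ?M) (f ` K)"
    if "continuous_map (subtopology ?T K) (mtopology_of ?M) f" for f
  proof -
    have "compactin (subtopology ?T K) K"
      using assms by (simp add: compactin_subtopology)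
    then have "compactin (mtopology_of ?M) (f ` K)"
      using that by (rule image_compactin)
    then show ?thesis
      unfolding mtopology_of_def
      by (rule Metric_space.compactin_imp_mbounded[OF Metric_space_mspace_mdist])
  qed
  then show ?thesis
    unfolding unif_metric_def cont_funs_def mspace_cfunspace K
    using continuous_map_funspace[of "subtopology ?T K" "mtopology_of ?M"] K
    by (auto simp del: topspace_subtopology)
qed

end

theory Submission
  imports Defs "HOL-Computational_Algebra.Polynomial"
begin

text \<open>
  Let \<open>A\<close> be the locally uniform closure of the span of all compositions of affine maps and \<open>\<sigma>\<close>.
  If \<open>t\<^sup>j f (w t + b) \<in> A\<close> for all \<open>w, b\<close>, then, integrating \<open>f\<close> over an interval of length \<open>h\<close> and
  differentiating in \<open>w\<close>, also \<open>t\<^bsup>j+1\<^esup> (f (w t + b + h) - f (w t + b)) \<in> A\<close>; setting \<open>w = 0\<close> after \<open>j\<close>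
  steps shows \<open>t\<^sup>j \<in> A\<close> as soon as some \<open>j\<close>-th difference of \<open>f\<close> is nonzero.  If \<open>t\<^sup>j \<in> A\<close> then
  \<open>\<sigma>\<^sup>j \<in> A\<close>, and the differences of order \<open>j + 1\<close> of \<open>\<sigma>\<close> and \<open>\<sigma>\<^sup>j\<close> cannot both vanish: on a grid, \<open>\<sigma>\<close> would be a
  polynomial of degree at least 2 whose \<open>j\<close>-th power has degree at most \<open>j\<close>.  Hence \<open>A\<close> contains all
  powers and therefore \<open>exp\<close>, and since the exponentials of linear forms span an algebra, the
  Stone--Weierstrass theorem makes finite sums of \<open>g (l x)\<close>, with \<open>g\<close> such a composition and \<open>l\<close>
  linear, dense among the continuous functions on \<open>K\<close>.

  A network of width \<open>c\<^sub>1 + c\<^sub>2 + 2\<close> keeps the input in \<open>c\<^sub>1\<close> channels and accumulates the output in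
  \<open>c\<^sub>2\<close> channels.  It adds one term \<open>g (l x)\<close> at a time: the first spare channel loads \<open>l x\<close>, is
  transformed by \<open>g\<close> in place, and is shifted down and up so that only the desired entry survives.
  The second spare channel carries a constant.
\<close>

subsection \<open>Functions approximable by compositions with the activation\<close>

text \<open>These are the scalar functions that a single hidden channel can apply in place. The free
  affine map after each activation makes the set closed under composition.\<close>

inductive_set comps :: "(real \<Rightarrow> real) \<Rightarrow> (real \<Rightarrow> real) set" for \<sigma>
  where
    comps_affine: "(\<lambda>t. w * t + b) \<in> comps \<sigma>"
  | comps_step: "g \<in> comps \<sigma> \<Longrightarrow> (\<lambda>t. w * \<sigma> (g t) + b) \<in> comps \<sigma>"

text \<open>Scalar multiples are absorbed into the summands, since \<open>comps\<close> is closed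
  under affine post-composition.\<close>

inductive_set comp_span :: "(real \<Rightarrow> real) \<Rightarrow> (real \<Rightarrow> real) set" for \<sigma>
  where
    comp_span_zero: "(\<lambda>t. 0) \<in> comp_span \<sigma>"
  | comp_span_add_comps:
      "f \<in> comp_span \<sigma> \<Longrightarrow> g \<in> comps \<sigma> \<Longrightarrow> (\<lambda>t. f t + g t) \<in> comp_span \<sigma>"

definition approximable :: "(real \<Rightarrow> real) \<Rightarrow> (real \<Rightarrow> real) set"
  where "approximable \<sigma> = {f. \<forall>r e. 0 < e \<longrightarrow> (\<exists>g\<in>comp_span \<sigma>. \<forall>t. \<bar>t\<bar> \<le> r \<longrightarrow> \<bar>f t - g t\<bar> < e)}"

text \<open>Only the innermost affine map of \<open>f\<close> meets \<open>g\<close>, and it merges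
  with the outermost affine map of \<open>g\<close>, whichever constructor produced
  \<open>g\<close>.\<close>

lemma comps_comp:
  assumes "f \<in> comps \<sigma>" "g \<in> comps \<sigma>"
  shows "(\<lambda>t. f (g t)) \<in> comps \<sigma>"
  using assms
proof induction
  case (comps_affine w b)
  from comps_affine show ?case
  proof cases
    case (comps_affine w' b')
    then have "(\<lambda>t. w * g t + b) = (\<lambda>t. (w * w') * t + (w * b' + b))"
      by (auto simp: algebra_simps)
    then show ?thesis
      using comps.comps_affine by metis
  next
    case (comps_step g' w' b')
    then have "(\<lambda>t. w * g t + b) = (\<lambda>t. (w * w') * \<sigma> (g' t) + (w * b' + b))"
      by (auto simp: algebra_simps)
    then show ?thesis
      using comps_step comps.comps_step by metis
  qed
next
  case (comps_step h w b)
  then show ?case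
    by (intro comps.comps_step)
qed

lemma comp_span_add:
  assumes "g \<in> comp_span \<sigma>" "f \<in> comp_span \<sigma>"
  shows "(\<lambda>t. f t + g t) \<in> comp_span \<sigma>"
  using assms
proof (induction arbitrary: f)
  case comp_span_zero
  then show ?case by simp
next
  case (comp_span_add_comps g h)
  from comp_span.comp_span_add_comps[OF comp_span_add_comps.IH[OF comp_span_add_comps.prems]
      comp_span_add_comps.hyps(2)]
  show ?case by (simp add: add.assoc)
qed

lemma comp_span_comp:
  assumes "f \<in> comp_span \<sigma>" "g \<in> comps \<sigma>"
  shows "(\<lambda>t. f (g t)) \<in> comp_span \<sigma>"
  using assms
proof induction
  case comp_span_zero
  show ?case by (rule comp_span.comp_span_zero)
next
  case (comp_span_add_comps f h)
  then show ?case
    by (intro comp_span.comp_span_add_comps comps_comp[of h \<sigma> g])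
qed

lemma comp_span_scale:
  assumes "f \<in> comp_span \<sigma>"
  shows "(\<lambda>t. c * f t) \<in> comp_span \<sigma>"
  using assms
proof induction
  case comp_span_zero
  then show ?case by (simp add: comp_span.comp_span_zero)
next
  case (comp_span_add_comps f g)
  from comps_comp[OF comps_affine[of c 0] \<open>g \<in> comps \<sigma>\<close>] have "(\<lambda>t. c * g t) \<in> comps \<sigma>"
    by simp
  then show ?case
    unfolding distrib_left by (rule comp_span.comp_span_add_comps[OF comp_span_add_comps.IH])
qed

lemma approximableD:
  "f \<in> approximable \<sigma> \<Longrightarrow> 0 < e \<Longrightarrow> \<exists>g\<in>comp_span \<sigma>. \<forall>t. \<bar>t\<bar> \<le> r \<longrightarrow> \<bar>f t - g t\<bar> < e"
  unfolding approximable_def by blast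

lemma approximable_comps:
  assumes "g \<in> comps \<sigma>"
  shows "g \<in> approximable \<sigma>"
proof -
  have "g \<in> comp_span \<sigma>"
    using comp_span_add_comps[OF comp_span_zero assms] by simp
  then show ?thesis
    unfolding approximable_def by force
qed

lemma approximable_add:
  assumes "f \<in> approximable \<sigma>" "g \<in> approximable \<sigma>"
  shows "(\<lambda>t. f t + g t) \<in> approximable \<sigma>"
  unfolding approximable_def
proof (intro CollectI allI impI)
  fix r e :: real assume e: "0 < e"
  obtain f' where f': "f' \<in> comp_span \<sigma>" "\<And>t. \<bar>t\<bar> \<le> r \<Longrightarrow> \<bar>f t - f' t\<bar> < e / 2"
    using approximableD[OF assms(1), of "e / 2" r] e by auto
  obtain g' where g': "g' \<in> comp_span \<sigma>" "\<And>t. \<bar>t\<bar> \<le> r \<Longrightarrow> \<bar>g t - g' t\<bar> < e / 2"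
    using approximableD[OF assms(2), of "e / 2" r] e by auto
  have close: "\<bar>f t + g t - (f' t + g' t)\<bar> < e" if "\<bar>t\<bar> \<le> r" for t
    using f'(2)[OF that] g'(2)[OF that] by linarith
  show "\<exists>h\<in>comp_span \<sigma>. \<forall>t. \<bar>t\<bar> \<le> r \<longrightarrow> \<bar>f t + g t - h t\<bar> < e"
    by (rule bexI[OF _ comp_span_add[OF g'(1) f'(1)]]) (use close in simp)
qed

lemma approximable_scale:
  assumes "f \<in> approximable \<sigma>"
  shows "(\<lambda>t. c * f t) \<in> approximable \<sigma>"
  unfolding approximable_def
proof (intro CollectI allI impI)
  fix r e :: real assume e: "0 < e"
  then obtain g where g: "g \<in> comp_span \<sigma>" "\<And>t. \<bar>t\<bar> \<le> r \<Longrightarrow> \<bar>f t - g t\<bar> < e / (\<bar>c\<bar> + 1)"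
    using approximableD[OF assms, of "e / (\<bar>c\<bar> + 1)" r] by auto
  have close: "\<bar>c * f t - c * g t\<bar> < e" if "\<bar>t\<bar> \<le> r" for t
  proof -
    have "\<bar>c * f t - c * g t\<bar> = \<bar>c\<bar> * \<bar>f t - g t\<bar>"
      by (simp add: abs_mult right_diff_distrib[symmetric])
    also have "\<dots> \<le> (\<bar>c\<bar> + 1) * \<bar>f t - g t\<bar>"
      by (simp add: mult_right_mono)
    also have "\<dots> < e"
      using g(2)[OF that] by (simp add: pos_less_divide_eq mult.commute add_pos_nonneg)
    finally show ?thesis .
  qed
  show "\<exists>h\<in>comp_span \<sigma>. \<forall>t. \<bar>t\<bar> \<le> r \<longrightarrow> \<bar>c * f t - h t\<bar> < e"
    by (rule bexI[OF _ comp_span_scale[OF g(1), of c]]) (use close in simp)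
qed

lemma approximable_const: "(\<lambda>t. c) \<in> approximable \<sigma>"
  using approximable_comps[OF comps_affine[of 0 c]] by simp

lemma approximable_sum:
  assumes "finite I" "\<And>i. i \<in> I \<Longrightarrow> f i \<in> approximable \<sigma>"
  shows "(\<lambda>t. \<Sum>i\<in>I. f i t) \<in> approximable \<sigma>"
  using assms
proof (induction I)
  case empty
  then show ?case by (simp add: approximable_const)
next
  case (insert i I)
  then have "(\<lambda>t. f i t + (\<Sum>i\<in>I. f i t)) \<in> approximable \<sigma>"
    by (intro approximable_add) auto
  then show ?case
    using insert.hyps by simp
qed

text \<open>Closedness under locally uniform limits. Restricting to positive radii lets later error
  budgets divide by powers of \<open>r\<close>.\<close>

lemma approximable_limit:
  assumes "\<And>r e. 0 < r \<Longrightarrow> 0 < e \<Longrightarrow> \<exists>g\<in>approximable \<sigma>. \<forall>t. \<bar>t\<bar> \<le> r \<longrightarrow> \<bar>f t - g t\<bar> \<le> e"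
  shows "f \<in> approximable \<sigma>"
  unfolding approximable_def
proof (intro CollectI allI impI)
  fix r e :: real assume e: "0 < e"
  obtain g where g: "g \<in> approximable \<sigma>" "\<And>t. \<bar>t\<bar> \<le> \<bar>r\<bar> + 1 \<Longrightarrow> \<bar>f t - g t\<bar> \<le> e / 2"
    using assms[of "\<bar>r\<bar> + 1" "e / 2"] e by (auto simp: add_nonneg_pos)
  obtain h where h: "h \<in> comp_span \<sigma>" "\<And>t. \<bar>t\<bar> \<le> r \<Longrightarrow> \<bar>g t - h t\<bar> < e / 2"
    using approximableD[OF g(1), of "e / 2" r] e by auto
  have "\<bar>f t - h t\<bar> < e" if "\<bar>t\<bar> \<le> r" for t
    using g(2)[of t] h(2)[OF that] that by linarith
  then show "\<exists>h\<in>comp_span \<sigma>. \<forall>t. \<bar>t\<bar> \<le> r \<longrightarrow> \<bar>f t - h t\<bar> < e"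
    using h(1) by blast
qed

lemma comps_continuous:
  assumes "continuous_on UNIV \<sigma>" "g \<in> comps \<sigma>"
  shows "continuous_on UNIV g"
  using assms(2)
  by induction (auto intro!: continuous_intros continuous_on_compose2[OF assms(1)])

lemma continuous_bounded_interval:
  fixes g :: "real \<Rightarrow> real"
  assumes "continuous_on UNIV g"
  obtains M where "0 < M" "\<And>t. \<bar>t\<bar> \<le> r \<Longrightarrow> \<bar>g t\<bar> \<le> M"
proof -
  have "bounded (g ` {-r..r})"
    by (intro compact_imp_bounded compact_continuous_image continuous_on_subset[OF assms]) auto
  then obtain M where "0 < M" "\<forall>x\<in>g ` {-r..r}. norm x \<le> M"
    unfolding bounded_pos by blast
  then show thesis
    by (intro that[of M]) (simp_all add: abs_le_iff[of _ r] minus_le_iff)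
qed

text \<open>The map \<open>g\<close> sends \<open>[-r, r]\<close> into some \<open>[-M, M]\<close>,
  so approximating \<open>f\<close> there suffices. With \<open>f\<close> a power and
  \<open>g\<close> an affine map followed by \<open>\<sigma>\<close>, this is how powers of
  \<open>\<sigma>\<close> enter.\<close>

lemma approximable_comp:
  assumes "continuous_on UNIV \<sigma>" "f \<in> approximable \<sigma>" "g \<in> comps \<sigma>"
  shows "(\<lambda>t. f (g t)) \<in> approximable \<sigma>"
  unfolding approximable_def
proof (intro CollectI allI impI)
  fix r e :: real assume e: "0 < e"
  obtain M where M: "\<And>t. \<bar>t\<bar> \<le> r \<Longrightarrow> \<bar>g t\<bar> \<le> M"
    using continuous_bounded_interval[OF comps_continuous[OF assms(1,3)]] by blast
  obtain h where h: "h \<in> comp_span \<sigma>" "\<And>t. \<bar>t\<bar> \<le> M \<Longrightarrow> \<bar>f t - h t\<bar> < e"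
    using approximableD[OF assms(2) e] by blast
  show "\<exists>h\<in>comp_span \<sigma>. \<forall>t. \<bar>t\<bar> \<le> r \<longrightarrow> \<bar>f (g t) - h t\<bar> < e"
    by (rule bexI[OF _ comp_span_comp[OF h(1) assms(3)]]) (use h(2) M in simp)
qed

section \<open>Raising the power of the variable by integration and differentiation\<close>

text \<open>The function \<open>F u - u * f p\<close> has derivative \<open>f z - f p\<close>, which
  is small near \<open>p\<close>; the mean value inequality then gives a bound uniform in
  \<open>p\<close>.\<close>

lemma uniform_derivative:
  fixes F f :: "real \<Rightarrow> real"
  assumes F: "\<And>x. (F has_real_derivative f x) (at x)"
    and f: "continuous_on UNIV f" and e: "0 < e"
  obtains \<delta> where "0 < \<delta>"
    "\<And>p v. \<bar>p\<bar> \<le> R \<Longrightarrow> \<bar>v\<bar> < \<delta> \<Longrightarrow> \<bar>F (p + v) - F p - v * f p\<bar> \<le> e * \<bar>v\<bar>"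
proof -
  have "uniformly_continuous_on {-(R+1)..R+1} f"
    by (intro compact_uniformly_continuous continuous_on_subset[OF f]) auto
  then obtain d where d: "0 < d"
    "\<And>x y. x \<in> {-(R+1)..R+1} \<Longrightarrow> y \<in> {-(R+1)..R+1} \<Longrightarrow> dist y x < d \<Longrightarrow> dist (f y) (f x) < e"
    unfolding uniformly_continuous_on_def using e by metis
  show thesis
  \<comment> \<open>The cap 1 keeps \<open>p + v\<close> in the enlarged interval on which
    \<open>f\<close> is uniformly continuous.\<close>
  proof (rule that[of "min d 1"])
    show "0 < min d 1" using d(1) by simp
    fix p v :: real assume p: "\<bar>p\<bar> \<le> R" and v: "\<bar>v\<bar> < min d 1"
    have "norm ((F (p + v) - (p + v) * f p) - (F p - p * f p)) \<le> e * norm (p + v - p)"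
    proof (rule field_differentiable_bound[of "closed_segment p (p + v)" _ "\<lambda>z. f z - f p"])
      fix z assume z: "z \<in> closed_segment p (p + v)"
      show "((\<lambda>u. F u - u * f p) has_field_derivative f z - f p) (at z within closed_segment p (p + v))"
        by (auto intro!: derivative_eq_intros has_field_derivative_at_within[OF F])
      have "\<bar>z - p\<bar> \<le> \<bar>v\<bar>"
        using z by (auto simp: closed_segment_eq_real_ivl split: if_splits)
      then have "dist (f z) (f p) < e"
        using p v by (intro d(2)) (auto simp: dist_real_def abs_le_iff)
      then show "norm (f z - f p) \<le> e"
        by (simp add: dist_norm)
    qed auto
    then show "\<bar>F (p + v) - F p - v * f p\<bar> \<le> e * \<bar>v\<bar>"
      by (simp add: algebra_simps)
  qed
qed

text \<open>Two limits stay within the closed set: Riemann sums produce \<open>t ^ j\<close> times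
  an integral of \<open>f\<close> over a window of length \<open>h\<close>, and differentiating that
  in the slope \<open>w\<close> brings down one more factor \<open>t\<close>. Integrating first
  makes the argument work for merely continuous \<open>f\<close>.\<close>

lemma approximable_power_diff:
  fixes f :: "real \<Rightarrow> real"
  assumes f: "continuous_on UNIV f"
    and A: "\<And>w b. (\<lambda>t. t ^ j * f (w * t + b)) \<in> approximable \<sigma>"
  shows "(\<lambda>t. t ^ Suc j * (f (w * t + b + h) - f (w * t + b))) \<in> approximable \<sigma>"
proof -
  have "\<exists>F. \<forall>x. - \<infinity> < ereal x \<longrightarrow> ereal x < \<infinity> \<longrightarrow> (F has_vector_derivative f x) (at x)"
    using f by (intro einterval_antiderivative) (auto simp: continuous_on_eq_continuous_at)
  then obtain F where F: "\<And>x. (F has_real_derivative f x) (at x)"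
    by (auto simp: has_real_derivative_iff_has_vector_derivative)
  \<comment> \<open>This is the integral of \<open>f\<close> over \<open>[s, s + h]\<close>, with
    orientation if \<open>h\<close> is negative.\<close>
  define H where "H s = F (s + h) - F s" for s
  have H: "(H has_real_derivative (f (x + h) - f x)) (at x)" for x
    unfolding H_def
    by (intro DERIV_diff F) (use DERIV_shift[of F "f (x + h)" x h] F in simp)
  have fh: "continuous_on UNIV (\<lambda>x. f (x + h) - f x)"
    by (intro continuous_intros continuous_on_compose2[OF f]) auto
  have AH: "(\<lambda>t. t ^ j * H (w * t + b)) \<in> approximable \<sigma>" for w b
  proof (rule approximable_limit)
    fix r e :: real assume r: "0 < r" and e: "0 < e"
    \<comment> \<open>Chosen so that \<open>r ^ j * e' * \<bar>h\<bar> \<le> e\<close>; adding 1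
      covers \<open>h = 0\<close>.\<close>
    define e' where "e' = e / (r ^ j * (\<bar>h\<bar> + 1))"
    have e': "0 < e'"
      using r e by (simp add: e'_def add_nonneg_pos)
    obtain \<delta> where \<delta>: "0 < \<delta>" "\<And>p v. \<bar>p\<bar> \<le> \<bar>w\<bar> * r + \<bar>b\<bar> + \<bar>h\<bar> \<Longrightarrow> \<bar>v\<bar> < \<delta> \<Longrightarrow>
        \<bar>F (p + v) - F p - v * f p\<bar> \<le> e' * \<bar>v\<bar>"
      using uniform_derivative[OF F f e'] by metis
    obtain n :: nat where n: "\<bar>h\<bar> / \<delta> < n"
      using reals_Archimedean2 by blast
    then have n0: "0 < real n"
      using \<delta>(1) by (smt (verit) divide_nonneg_pos)
    define v where "v = h / n"
    have nv: "real n * v = h" using n0 by (simp add: v_def)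
    have v: "\<bar>v\<bar> < \<delta>"
      using n n0 \<delta>(1) by (simp add: v_def field_simps)
    \<comment> \<open>The Riemann sum with \<open>n\<close> equal cells of signed length
      \<open>v\<close>. The increments of \<open>F\<close> telescope, and
      \<open>uniform_derivative\<close> bounds the error in each cell.\<close>
    define g where "g t = (\<Sum>i<n. v * (t ^ j * f (w * t + (b + i * v))))" for t
    have "g \<in> approximable \<sigma>"
      unfolding g_def by (intro approximable_sum approximable_scale A) auto
    moreover have "\<bar>t ^ j * H (w * t + b) - g t\<bar> \<le> e" if t: "\<bar>t\<bar> \<le> r" for t
    proof -
      define p where "p i = w * t + b + real i * v" for i
      have "H (w * t + b) = F (p n) - F (p 0)"
        by (simp add: H_def p_def nv)
      also have "\<dots> = (\<Sum>i<n. F (p (Suc i)) - F (p i))"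
        by (rule sum_lessThan_telescope[symmetric])
      finally have "t ^ j * H (w * t + b) - g t = t ^ j * (\<Sum>i<n. F (p i + v) - F (p i) - v * f (p i))"
        by (simp add: g_def p_def sum_distrib_left sum_subtractf[symmetric] algebra_simps)
      also have "\<bar>\<dots>\<bar> \<le> r ^ j * (\<Sum>i<n. e' * \<bar>v\<bar>)"
        unfolding abs_mult power_abs
      proof (intro mult_mono power_mono order.trans[OF sum_abs] sum_mono t \<delta>(2) v)
        fix i assume i: "i \<in> {..<n}"
        have "\<bar>w * t\<bar> \<le> \<bar>w\<bar> * r"
          using t by (simp add: abs_mult mult_left_mono)
        moreover have "\<bar>real i * v\<bar> \<le> real n * \<bar>v\<bar>"
          using i by (simp add: abs_mult mult_right_mono)
        moreover have "real n * \<bar>v\<bar> = \<bar>h\<bar>"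
          using nv n0 by (metis abs_mult abs_of_pos)
        ultimately show "\<bar>p i\<bar> \<le> \<bar>w\<bar> * r + \<bar>b\<bar> + \<bar>h\<bar>"
          unfolding p_def by linarith
      qed (use r in auto)
      also have "\<dots> = r ^ j * e' * \<bar>h\<bar>"
        using nv n0 by (metis abs_mult abs_of_pos card_lessThan mult.assoc mult.left_commute sum_constant)
      also have "\<dots> \<le> e"
        using r e by (simp add: e'_def divide_simps mult_left_mono)
      finally show ?thesis .
    qed
    ultimately show "\<exists>g\<in>approximable \<sigma>. \<forall>t. \<bar>t\<bar> \<le> r \<longrightarrow> \<bar>t ^ j * H (w * t + b) - g t\<bar> \<le> e"
      by blast
  qed
  show ?thesis
  proof (rule approximable_limit)
    fix r e :: real assume r: "0 < r" and e: "0 < e"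
    have e': "0 < e / r ^ Suc j"
      using r e by simp
    obtain \<delta> where \<delta>: "0 < \<delta>" "\<And>p v. \<bar>p\<bar> \<le> \<bar>w\<bar> * r + \<bar>b\<bar> \<Longrightarrow> \<bar>v\<bar> < \<delta> \<Longrightarrow>
        \<bar>H (p + v) - H p - v * (f (p + h) - f p)\<bar> \<le> e / r ^ Suc j * \<bar>v\<bar>"
      using uniform_derivative[OF H fh e'] by metis
    \<comment> \<open>Half of the admissible step, so that \<open>\<bar>u * t\<bar>\<close> stays
      below \<open>\<delta>\<close> on the whole interval; \<open>g\<close> below is the difference
      quotient in the slope.\<close>
    define u where "u = \<delta> / (2 * r)"
    have u: "0 < u" using \<delta>(1) r by (simp add: u_def)
    define g where "g t = (1 / u) * (t ^ j * H ((w + u) * t + b)) + (- 1 / u) * (t ^ j * H (w * t + b))" for t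
    have "g \<in> approximable \<sigma>"
      unfolding g_def by (intro approximable_add approximable_scale AH)
    moreover have "\<bar>t ^ Suc j * (f (w * t + b + h) - f (w * t + b)) - g t\<bar> \<le> e" if t: "\<bar>t\<bar> \<le> r" for t
    proof -
      define p where "p = w * t + b"
      have p: "\<bar>p\<bar> \<le> \<bar>w\<bar> * r + \<bar>b\<bar>"
      proof -
        have "\<bar>w * t\<bar> \<le> \<bar>w\<bar> * r"
          using t by (simp add: abs_mult mult_left_mono)
        then show ?thesis unfolding p_def by linarith
      qed
      have "u * \<bar>t\<bar> \<le> u * r" using t u by simp
      also have "\<dots> < \<delta>" using r \<delta>(1) by (simp add: u_def)
      finally have ut: "\<bar>u * t\<bar> < \<delta>" using u by (simp add: abs_mult)
      have eq: "t ^ Suc j * (f (w * t + b + h) - f (w * t + b)) - g t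
          = - (t ^ j / u) * (H (p + u * t) - H p - (u * t) * (f (p + h) - f p))"
        using u by (simp add: g_def p_def field_simps)
      have "\<bar>t ^ Suc j * (f (w * t + b + h) - f (w * t + b)) - g t\<bar> \<le> (\<bar>t\<bar> ^ j / u) * (e / r ^ Suc j * \<bar>u * t\<bar>)"
        unfolding eq abs_mult[of "- _"] using u \<delta>(2)[OF p ut]
        by (intro mult_mono) (auto simp: power_abs)
      also have "\<dots> = e / r ^ Suc j * \<bar>t\<bar> ^ Suc j"
        using u by (simp add: abs_mult)
      also have "\<dots> \<le> e / r ^ Suc j * r ^ Suc j"
        using t e' by (intro mult_left_mono power_mono) auto
      also have "\<dots> = e" using r by simp
      finally show ?thesis .
    qed
    ultimately show "\<exists>g\<in>approximable \<sigma>. \<forall>t. \<bar>t\<bar> \<le> r \<longrightarrow>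
        \<bar>t ^ Suc j * (f (w * t + b + h) - f (w * t + b)) - g t\<bar> \<le> e"
      by blast
  qed
qed

section \<open>Finite differences and the approximation of powers\<close>

definition fdiff :: "real \<Rightarrow> (real \<Rightarrow> real) \<Rightarrow> real \<Rightarrow> real"
  where "fdiff h f x = f (x + h) - f x"

lemma fdiff_continuous:
  assumes "continuous_on UNIV f"
  shows "continuous_on UNIV ((fdiff h ^^ j) f)"
proof (induction j)
  case (Suc j)
  have "(fdiff h ^^ Suc j) f = (\<lambda>x. (fdiff h ^^ j) f (x + h) - (fdiff h ^^ j) f x)"
    by (rule ext) (simp add: fdiff_def)
  moreover have "continuous_on UNIV \<dots>"
    by (intro continuous_intros Suc continuous_on_compose2[OF Suc]) auto
  ultimately show ?case by simp
qed (use assms in simp)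

text \<open>Iterating \<open>approximable_power_diff\<close> trades one difference for one power of
  \<open>t\<close>. At slope 0 the remaining factor is the constant value at \<open>b\<close>, which
  can be divided out.\<close>

lemma power_approximable:
  assumes f: "continuous_on UNIV f"
    and A: "\<And>w b. (\<lambda>t. f (w * t + b)) \<in> approximable \<sigma>"
    and nz: "(fdiff h ^^ j) f b \<noteq> 0"
  shows "(\<lambda>t. t ^ j) \<in> approximable \<sigma>"
proof -
  have "(\<lambda>t. t ^ j * (fdiff h ^^ j) f (w * t + b)) \<in> approximable \<sigma>" for w b
  proof (induction j arbitrary: w b)
    case 0
    then show ?case using A by simp
  next
    case (Suc j)
    show ?case
      using approximable_power_diff[OF fdiff_continuous[OF f] Suc] by (simp add: fdiff_def)
  qed
  from approximable_scale[OF this[of 0 b], of "1 / (fdiff h ^^ j) f b"] show ?thesis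
    using nz by simp
qed

text \<open>Newton's forward difference formula on a grid with fixed step \<open>h\<close>. The
  inductive hypothesis expands \<open>fdiff h f\<close>, and summation along the grid raises the
  binomial index.\<close>

lemma fdiff_zero_imp_binomial:
  assumes "\<And>x. (fdiff h ^^ Suc N) f x = 0"
  shows "\<exists>c. \<forall>n. f (b + real n * h) = (\<Sum>i\<le>N. c i * real (n choose i))"
  using assms
proof (induction N arbitrary: f)
  case 0
  then have "f (x + h) = f x" for x
    by (simp add: fdiff_def)
  from this[of "b + real n * h" for n] have "f (b + real n * h) = f b" for n
    by (induction n) (simp_all add: algebra_simps)
  then show ?case by auto
next
  case (Suc N)
  have "\<And>x. (fdiff h ^^ Suc N) (fdiff h f) x = 0"
    using Suc.prems by (simp add: funpow_swap1)
  then obtain c where c: "\<And>n. fdiff h f (b + real n * h) = (\<Sum>i\<le>N. c i * real (n choose i))"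
    using Suc.IH by blast
  \<comment> \<open>The value at \<open>b\<close> becomes the constant term and the coefficients of
    the difference move up by one; Pascal's rule then closes the induction on
    \<open>n\<close>.\<close>
  define c' where "c' = case_nat (f b) c"
  have "f (b + real n * h) = (\<Sum>i\<le>Suc N. c' i * real (n choose i))" for n
  proof (induction n)
    case 0
    then show ?case
      by (simp add: c'_def sum.atMost_Suc_shift del: sum.atMost_Suc)
  next
    case (Suc n)
    have "f (b + real (Suc n) * h) = f (b + real n * h) + fdiff h f (b + real n * h)"
      by (simp add: fdiff_def algebra_simps)
    also have "\<dots> = (\<Sum>i\<le>Suc N. c' i * real (n choose i)) + (\<Sum>i\<le>N. c i * real (n choose i))"
      by (simp only: Suc c)
    also have "\<dots> = (\<Sum>i\<le>Suc N. c' i * real (Suc n choose i))"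
      by (simp add: c'_def sum.atMost_Suc_shift sum.distrib distrib_left del: sum.atMost_Suc)
    finally show ?case .
  qed
  then show ?case by blast
qed

text \<open>For fixed \<open>i\<close> the binomial coefficient is a falling factorial divided by
  \<open>fact i\<close>, hence a polynomial of degree \<open>i\<close> in \<open>n\<close>.\<close>

lemma binomial_sum_poly:
  fixes c :: "nat \<Rightarrow> real"
  obtains p where "degree p \<le> N" "\<And>n. (\<Sum>i\<le>N. c i * real (n choose i)) = poly p (real n)"
proof
  define q where "q i = smult (c i / fact i) (\<Prod>k<i. [:- real k, 1:])" for i
  have "degree (q i) \<le> i" for i
  proof -
    have "degree (\<Prod>k<i. [:- real k, 1:]) = (\<Sum>k<i. degree [:- real k, 1:])"
      by (intro degree_prod_sum_eq) auto
    then show ?thesis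
      unfolding q_def using degree_smult_le[of "c i / fact i" "\<Prod>k<i. [:- real k, 1:]"] by simp
  qed
  then show "degree (\<Sum>i\<le>N. q i) \<le> N"
    by (intro degree_sum_le) (auto intro: order.trans)
  show "(\<Sum>i\<le>N. c i * real (n choose i)) = poly (\<Sum>i\<le>N. q i) (real n)" for n
    by (simp add: q_def poly_sum poly_prod binomial_gbinomial gbinomial_prod_rev atLeast0LessThan)
qed

lemma fdiff_zero_imp_poly:
  assumes "\<And>x. (fdiff h ^^ Suc N) f x = 0"
  obtains p where "degree p \<le> N" "\<And>n. f (b + real n * h) = poly p (real n)"
  using fdiff_zero_imp_binomial[OF assms, of b] binomial_sum_poly by metis

text \<open>Vanishing second differences make \<open>f\<close> affine along every arithmetic
  progression starting at 0. The deviation \<open>g\<close> from the chord through 0 and 1 therefore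
  vanishes on the rationals, and by continuity everywhere.\<close>

lemma affine_if_second_difference_zero:
  fixes f :: "real \<Rightarrow> real"
  assumes f: "continuous_on UNIV f" and zero: "\<And>h x. (fdiff h ^^ 2) f x = 0"
  shows "\<exists>a b. \<forall>t. f t = a * t + b"
proof -
  have mid: "f (x + 2 * h) = 2 * f (x + h) - f x" for x h
    using zero[of h x] by (simp add: numeral_2_eq_2 fdiff_def algebra_simps)
  have grid: "f (real n * h) = f 0 + real n * (f h - f 0)" for n h
  proof (induction n rule: induct_nat_012)
    case (ge2 n)
    have "f (real (Suc (Suc n)) * h) = f (real n * h + 2 * h)"
      by (simp add: algebra_simps)
    also have "\<dots> = 2 * f (real (Suc n) * h) - f (real n * h)"
      using mid[of "real n * h" h] by (simp add: algebra_simps)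
    also have "\<dots> = 2 * (f 0 + real (Suc n) * (f h - f 0)) - (f 0 + real n * (f h - f 0))"
      by (simp only: ge2)
    finally show ?case
      by (simp add: algebra_simps)
  qed auto
  define g where "g t = f t - f 0 - t * (f 1 - f 0)" for t
  have neg: "f (- h) = 2 * f 0 - f h" for h
    using mid[of "-h" h] by simp
  have gn: "g (real n * h) = real n * g h" for n h
    unfolding g_def grid by (simp add: algebra_simps)
  have gneg: "g (- h) = - g h" for h
    by (simp add: g_def neg algebra_simps)
  have g1: "g (real n) = 0" for n
    using gn[of n 1] by (simp add: g_def)
  have gi: "g (of_int z) = 0" for z
  proof (cases z)
    case (nonneg n)
    then show ?thesis using g1 by simp
  next
    case (neg n)
    then show ?thesis using g1[of "Suc n"] gneg[of "real (Suc n)"] by simp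
  qed
  have "g q = 0" if q: "q \<in> \<rat>" for q
  proof -
    obtain z n where "n \<noteq> 0" "q = of_int z / real n"
      using q unfolding Rats_eq_int_div_nat by auto
    then show ?thesis
      using gn[of n q] gi[of z] by simp
  qed
  moreover have "continuous_on UNIV g"
    unfolding g_def by (intro continuous_intros f)
  ultimately have "g t = 0" for t
    using continuous_constant_on_closure[of \<rat> g 0 t] by (simp add: Rats_closure_real)
  then have "f t = (f 1 - f 0) * t + f 0" for t
    unfolding g_def by (simp add: algebra_simps)
  then show ?thesis by blast
qed

theorem powers_approximable:
  assumes \<sigma>: "continuous_on UNIV \<sigma>" and na: "\<not> (\<exists>a b. \<forall>t. \<sigma> t = a * t + b)"
  shows "(\<lambda>t. t ^ j) \<in> approximable \<sigma>"
proof -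
  have comps_\<sigma>: "(\<lambda>t. \<sigma> (w * t + b)) \<in> comps \<sigma>" for w b
    using comps_step[OF comps_affine[of w b], where w = 1 and b = 0] by simp
  have step: "(\<lambda>t. t ^ Suc j) \<in> approximable \<sigma>" if j: "1 \<le> j" "(\<lambda>t. t ^ j) \<in> approximable \<sigma>" for j
  proof (rule ccontr)
    assume n: "(\<lambda>t. t ^ Suc j) \<notin> approximable \<sigma>"
    have "(\<lambda>t. \<sigma> (w * t + b)) \<in> approximable \<sigma>" for w b
      by (intro approximable_comps comps_\<sigma>)
    from power_approximable[OF \<sigma> this] n have z1: "(fdiff h ^^ Suc j) \<sigma> x = 0" for h x
      by metis
    have "(\<lambda>t. \<sigma> (w * t + b) ^ j) \<in> approximable \<sigma>" for w b
      by (rule approximable_comp[OF \<sigma> j(2) comps_\<sigma>])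
    from power_approximable[OF continuous_on_power[OF \<sigma>] this] n
    have zj: "(fdiff h ^^ Suc j) (\<lambda>t. \<sigma> t ^ j) x = 0" for h x
      by metis
    \<comment> \<open>On this grid \<open>\<sigma>\<close> is visibly not affine, which forces
      degree at least 2 for the polynomial that represents it there.\<close>
    obtain h b where hb: "(fdiff h ^^ 2) \<sigma> b \<noteq> 0"
      using affine_if_second_difference_zero[OF \<sigma>] na by blast
    obtain p where p: "\<And>n. \<sigma> (b + real n * h) = poly p (real n)"
      using fdiff_zero_imp_poly[OF z1, where b = b] by metis
    obtain q where q: "degree q \<le> j" "\<And>n. \<sigma> (b + real n * h) ^ j = poly q (real n)"
      using fdiff_zero_imp_poly[OF zj, where b = b] by metis
    have "2 \<le> degree p"
    proof (rule ccontr)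
      assume "\<not> 2 \<le> degree p"
      then have "degree p \<le> 1" by simp
      then have pv: "p = [:coeff p 0, coeff p 1:]"
        by (auto simp: poly_eq_iff coeff_pCons coeff_eq_0 split: nat.split)
      have "(fdiff h ^^ 2) \<sigma> b = \<sigma> (b + real 2 * h) - 2 * \<sigma> (b + real 1 * h) + \<sigma> (b + real 0 * h)"
        by (simp add: numeral_2_eq_2 fdiff_def algebra_simps)
      also have "\<dots> = 0"
        unfolding p by (subst (1 2 3) pv) simp
      finally show False using hb by simp
    qed
    have "p ^ j = q"
    proof (rule ccontr)
      assume "p ^ j \<noteq> q"
      then have "finite {x. poly (p ^ j - q) x = 0}"
        by (intro poly_roots_finite) simp
      moreover have "range real \<subseteq> {x. poly (p ^ j - q) x = 0}"
        using p q(2) by (auto simp: poly_power)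
      ultimately have "finite (range real)"
        by (rule rev_finite_subset)
      then show False
        using finite_imageD[of real UNIV] by (simp add: inj_on_def)
    qed
    moreover have "degree (p ^ j) = j * degree p"
      using \<open>2 \<le> degree p\<close> by (subst degree_power_eq) auto
    ultimately have "j * degree p \<le> j"
      using q(1) by metis
    then show False
      using j(1) \<open>2 \<le> degree p\<close> by simp
  qed
  show ?thesis
  proof (induction j)
    case 0
    then show ?case by (simp add: approximable_const)
  next
    case (Suc j)
    show ?case
    \<comment> \<open>The degree comparison is contradictory only for \<open>j \<ge> 1\<close>, so
      the exponent 1 is obtained directly from an affine map.\<close>
    proof (cases "j = 0")
      case True
      then show ?thesis
        using approximable_comps[OF comps_affine[of 1 0]] by simp
    next
      case False
      then show ?thesis using step Suc by simp
    qed
  qed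
qed

corollary exp_approximable:
  assumes \<sigma>: "continuous_on UNIV \<sigma>" and na: "\<not> (\<exists>a b. \<forall>t. \<sigma> t = a * t + b)"
  shows "exp \<in> approximable \<sigma>"
proof (rule approximable_limit)
  fix r e :: real assume r: "0 < r" and e: "0 < e"
  \<comment> \<open>This dominates the Lagrange remainder on \<open>[-r, r]\<close>, since the
    intermediate point lies in the same interval.\<close>
  have "(\<lambda>n. exp r * (inverse (fact n) * r ^ n)) \<longlonglongrightarrow> exp r * 0"
    by (intro tendsto_mult tendsto_const summable_LIMSEQ_zero summable_exp)
  then obtain n where n: "exp r * (inverse (fact n) * r ^ n) < e"
    using e by (metis (no_types, lifting) eventually_sequentially mult_zero_right order_refl order_tendstoD(2))
  define g where "g t = (\<Sum>m<n. (1 / fact m) * t ^ m)" for t :: real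
  have "g \<in> approximable \<sigma>"
    unfolding g_def by (intro approximable_sum approximable_scale powers_approximable[OF assms]) auto
  moreover have "\<bar>exp t - g t\<bar> \<le> e" if t: "\<bar>t\<bar> \<le> r" for t
  proof -
    obtain u where u: "\<bar>u\<bar> \<le> \<bar>t\<bar>" "exp t = (\<Sum>m<n. t ^ m / fact m) + exp u / fact n * t ^ n"
      using Maclaurin_exp_le by blast
    have "g t = (\<Sum>m<n. t ^ m / fact m)"
      by (simp add: g_def)
    then have "\<bar>exp t - g t\<bar> = exp u * (inverse (fact n) * \<bar>t\<bar> ^ n)"
      unfolding u(2) by (simp add: abs_mult power_abs divide_inverse)
    also have "\<dots> \<le> exp r * (inverse (fact n) * r ^ n)"
      using u(1) t by (intro mult_mono power_mono) auto
    finally show ?thesis using n by simp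
  qed
  ultimately show "\<exists>g\<in>approximable \<sigma>. \<forall>t. \<bar>t\<bar> \<le> r \<longrightarrow> \<bar>exp t - g t\<bar> \<le> e"
    by blast
qed

subsection \<open>Density of ridge sums\<close>

definition lin :: "nat \<Rightarrow> nat \<Rightarrow> tensor \<Rightarrow> tensor \<Rightarrow> real"
  where "lin c d a x = (\<Sum>i = 1..c. \<Sum>m = 1..d. a i m * x i m)"

text \<open>Products of exponentials add the coefficient tensors, so this span is an algebra: the
  function ring for the Stone-Weierstrass theorem.\<close>

inductive_set exp_span :: "nat \<Rightarrow> nat \<Rightarrow> (tensor \<Rightarrow> real) set" for c d
  where
    exp_span_zero: "(\<lambda>x. 0) \<in> exp_span c d"
  | exp_span_add_exp: "f \<in> exp_span c d \<Longrightarrow> (\<lambda>x. f x + u * exp (lin c d a x)) \<in> exp_span c d"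

text \<open>Built one summand at a time because the network adds one summand at a time.\<close>

inductive_set ridge_sums :: "(real \<Rightarrow> real) \<Rightarrow> nat \<Rightarrow> nat \<Rightarrow> (tensor \<Rightarrow> real) set" for \<sigma> c d
  where
    ridge_sums_zero: "(\<lambda>x. 0) \<in> ridge_sums \<sigma> c d"
  | ridge_sums_add: "f \<in> ridge_sums \<sigma> c d \<Longrightarrow> g \<in> comps \<sigma> \<Longrightarrow>
      (\<lambda>x. f x + g (lin c d a x)) \<in> ridge_sums \<sigma> c d"

lemma exp_span_add:
  assumes "g \<in> exp_span c d" "f \<in> exp_span c d"
  shows "(\<lambda>x. f x + g x) \<in> exp_span c d"
  using assms
proof (induction arbitrary: f)
  case exp_span_zero
  then show ?case by simp
next
  case (exp_span_add_exp g u a)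
  from exp_span.exp_span_add_exp[OF exp_span_add_exp.IH[OF exp_span_add_exp.prems], of u a]
  show ?case by (simp add: add.assoc)
qed

lemma exp_span_mult_exp:
  assumes "f \<in> exp_span c d"
  shows "(\<lambda>x. f x * (u * exp (lin c d a x))) \<in> exp_span c d"
  using assms
proof induction
  case exp_span_zero
  show ?case using exp_span.exp_span_zero by simp
next
  case (exp_span_add_exp f v b)
  have "lin c d (\<lambda>i m. b i m + a i m) x = lin c d b x + lin c d a x" for x
    by (simp add: lin_def distrib_right sum.distrib)
  then have "(f x + v * exp (lin c d b x)) * (u * exp (lin c d a x))
      = f x * (u * exp (lin c d a x)) + (v * u) * exp (lin c d (\<lambda>i m. b i m + a i m) x)" for x
    by (simp add: exp_add algebra_simps)
  then show ?case
    using exp_span.exp_span_add_exp[OF exp_span_add_exp.IH] by presburger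
qed

lemma exp_span_mult:
  assumes "g \<in> exp_span c d" "f \<in> exp_span c d"
  shows "(\<lambda>x. f x * g x) \<in> exp_span c d"
  using assms
proof induction
  case exp_span_zero
  show ?case using exp_span.exp_span_zero by simp
next
  case (exp_span_add_exp g u a)
  show ?case
    unfolding distrib_left
    by (intro exp_span_add[OF exp_span_mult_exp] exp_span_add_exp)
qed

lemma exp_span_scaled_exp: "(\<lambda>x. u * exp (lin c d a x)) \<in> exp_span c d"
  using exp_span_add_exp[OF exp_span_zero] by simp

lemma ridge_sums_add_comp_span:
  assumes "g \<in> comp_span \<sigma>" "f \<in> ridge_sums \<sigma> c d"
  shows "(\<lambda>x. f x + g (lin c d a x)) \<in> ridge_sums \<sigma> c d"
  using assms
proof (induction arbitrary: f)
  case comp_span_zero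
  then show ?case by simp
next
  case (comp_span_add_comps g h)
  from ridge_sums_add[OF comp_span_add_comps.IH[OF comp_span_add_comps.prems]
      comp_span_add_comps.hyps(2), of a]
  show ?case by (simp add: add.assoc)
qed

lemma lin_bound:
  assumes "\<And>i m. i \<in> {1..c} \<Longrightarrow> m \<in> {1..d} \<Longrightarrow> \<bar>x i m\<bar> \<le> r"
  shows "\<bar>lin c d a x\<bar> \<le> (\<Sum>i = 1..c. \<Sum>m = 1..d. \<bar>a i m\<bar> * r)"
  unfolding lin_def
  by (intro order.trans[OF sum_abs] sum_mono) (simp add: abs_mult mult_left_mono assms)

text \<open>On the box each linear form takes values in a bounded interval, where a scaled
  exponential can be replaced by a member of \<open>comp_span\<close>.\<close>

lemma exp_span_approx:
  assumes exp: "exp \<in> approximable \<sigma>" and "f \<in> exp_span c d" and "0 < e"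
  shows "\<exists>g\<in>ridge_sums \<sigma> c d. \<forall>x. (\<forall>i\<in>{1..c}. \<forall>m\<in>{1..d}. \<bar>x i m\<bar> \<le> r) \<longrightarrow> \<bar>f x - g x\<bar> < e"
  using assms(2,3)
proof (induction arbitrary: e)
  case exp_span_zero
  then show ?case
    by (intro bexI[OF _ ridge_sums_zero]) simp
next
  case (exp_span_add_exp f u a)
  define R where "R = (\<Sum>i = 1..c. \<Sum>m = 1..d. \<bar>a i m\<bar> * r)"
  obtain g where g: "g \<in> ridge_sums \<sigma> c d"
    "\<And>x. \<forall>i\<in>{1..c}. \<forall>m\<in>{1..d}. \<bar>x i m\<bar> \<le> r \<Longrightarrow> \<bar>f x - g x\<bar> < e / 2"
    using exp_span_add_exp.IH[of "e / 2"] \<open>0 < e\<close> by auto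
  obtain h where h: "h \<in> comp_span \<sigma>" "\<And>t. \<bar>t\<bar> \<le> R \<Longrightarrow> \<bar>u * exp t - h t\<bar> < e / 2"
    using approximableD[OF approximable_scale[OF exp, of u], of "e / 2" R] \<open>0 < e\<close> by auto
  show ?case
  proof (rule bexI[OF _ ridge_sums_add_comp_span[OF h(1) g(1), of a]], intro allI impI)
    fix x :: tensor assume x: "\<forall>i\<in>{1..c}. \<forall>m\<in>{1..d}. \<bar>x i m\<bar> \<le> r"
    have "\<bar>lin c d a x\<bar> \<le> R"
      unfolding R_def using x by (intro lin_bound) blast
    from h(2)[OF this] g(2)[OF x]
    show "\<bar>f x + u * exp (lin c d a x) - (g x + h (lin c d a x))\<bar> < e"
      by linarith
  qed
qed

section \<open>The product topology and the metric on tensors\<close>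

lemma continuous_on_tensor_entry: "continuous_on S (\<lambda>x::tensor. x i m)"
  by (rule continuous_on_product_then_coordinatewise
      [OF continuous_on_product_then_coordinatewise[OF continuous_on_id]])

lemma continuous_on_lin: "continuous_on S (lin c d a)"
  unfolding lin_def[abs_def] by (intro continuous_intros continuous_on_tensor_entry)

lemma continuous_on_exp_span:
  assumes "f \<in> exp_span c d"
  shows "continuous_on S f"
  using assms
proof induction
  case exp_span_zero
  show ?case by (rule continuous_on_const)
next
  case (exp_span_add_exp f u a)
  then show ?case by (intro continuous_on_add continuous_on_mult continuous_on_const
      continuous_on_exp continuous_on_lin)
qed

lemma continuous_map_tensor_entry:
  "continuous_map (mtopology_of (tensor_metric c d)) euclideanreal (\<lambda>x. x i m)"
proof (cases "i \<in> {1..c} \<and> m \<in> {1..d}")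
  case True
  then have "Lipschitz_continuous_map (tensor_metric c d) euclidean_metric (\<lambda>x. x i m)"
    by (auto simp: Lipschitz_continuous_map_def dist_real_def intro!: exI[of _ 1] tensor_dist_ge)
  then show ?thesis
    using Lipschitz_continuous_imp_continuous_map by fastforce
next
  case False
  \<comment> \<open>Extensionality fixes the entries outside the index ranges: either the inner
    function returns \<open>undefined\<close>, or the channel itself is the function
    \<open>undefined\<close>.\<close>
  have "x i m = (if i \<in> {1..c} then undefined else undefined m)" if "x \<in> tensors c d" for x
    using that False by (auto simp: tensors_def PiE_def extensional_def)
  moreover have "continuous_map (mtopology_of (tensor_metric c d)) euclideanreal
      (\<lambda>x. if i \<in> {1..c} then undefined else undefined m)"
    by (simp add: continuous_map_const)
  ultimately show ?thesis
    by (elim continuous_map_eq) simp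
qed

text \<open>Stone-Weierstrass is applied in the type class topology, here the product topology. The
  identity from the metric space into it is continuous because every coordinate is, so compactness
  carries over.\<close>

lemma compact_tensors:
  assumes "compactin (mtopology_of (tensor_metric c d)) K"
  shows "compact K"
proof -
  have "continuous_map (mtopology_of (tensor_metric c d)) euclidean (\<lambda>x::tensor. x)"
    unfolding euclidean_product_topology[symmetric] continuous_map_componentwise_UNIV
    using continuous_map_tensor_entry by blast
  from image_compactin[OF assms this] show ?thesis
    by (simp add: compactin_euclidean_iff)
qed

lemma compact_tensors_bounded:
  fixes K :: "tensor set"
  assumes "compact K"
  obtains r where "\<And>x i m. x \<in> K \<Longrightarrow> i \<in> {1..c} \<Longrightarrow> m \<in> {1..d} \<Longrightarrow> \<bar>x i m\<bar> \<le> r"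
proof -
  define N where "N x = (\<Sum>(i, m)\<in>{1..c} \<times> {1..d}. \<bar>x i m\<bar>)" for x :: tensor
  have "continuous_on K N"
    unfolding N_def[abs_def] case_prod_beta by (intro continuous_intros continuous_on_tensor_entry)
  then have "bounded (N ` K)"
    using assms by (intro compact_imp_bounded compact_continuous_image)
  then obtain r where r: "\<And>x. x \<in> K \<Longrightarrow> norm (N x) \<le> r"
    unfolding bounded_iff by blast
  show thesis
  proof (rule that)
    fix x i m assume "x \<in> K" "i \<in> {1..c}" "m \<in> {1..d}"
    then have "(case (i, m) of (i, m) \<Rightarrow> \<bar>x i m\<bar>) \<le> N x"
      unfolding N_def by (intro member_le_sum) auto
    with r[OF \<open>x \<in> K\<close>] show "\<bar>x i m\<bar> \<le> r"
      by simp
  qed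
qed

text \<open>A metric ball restricts only finitely many coordinates, so relative to \<open>K\<close>
  it contains a product-open neighbourhood of its centre. This turns continuity for the metric into
  \<open>continuous_on\<close>.\<close>

lemma continuous_map_into_tensors:
  assumes "K \<subseteq> tensors c d"
  shows "continuous_map (top_of_set K) (mtopology_of (tensor_metric c d)) (\<lambda>x. x)"
proof -
  interpret Metric_space "tensors c d" "tensor_dist c d"
    by (rule Metric_space_tensors)
  have eq: "mtopology_of (tensor_metric c d) = mtopology"
    by (simp add: mtopology_of_def)
  show ?thesis
    unfolding eq continuous_map_to_metric
  proof (intro ballI allI impI)
    fix x and e :: real assume x: "x \<in> topspace (top_of_set K)" and e: "0 < e"
    define U where "U = (\<Inter>i\<in>{1..c}. \<Inter>m\<in>{1..d}. {y::tensor. \<bar>x i m - y i m\<bar> < e / 2})"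
    have "open U"
      unfolding U_def
      by (intro open_INT ballI open_Collect_less continuous_intros continuous_on_tensor_entry) auto
    then have "openin (top_of_set K) (K \<inter> U)"
      by (simp add: openin_open_Int)
    moreover have "x \<in> K \<inter> U"
      using x e by (simp add: U_def)
    moreover have "y \<in> mball x e" if "y \<in> K \<inter> U" for y
    proof -
      have "tensor_dist c d x y \<le> e / 2"
        unfolding tensor_dist_le_iff using that e by (auto simp: U_def intro: less_imp_le)
      then show ?thesis
        using that x assms e by auto
    qed
    ultimately show "\<exists>U. openin (top_of_set K) U \<and> x \<in> U \<and> (\<forall>y\<in>U. y \<in> mball x e)"
      by blast
  qed
qed

text \<open>Stone-Weierstrass approximates \<open>\<phi>\<close> by an element of
  \<open>exp_span\<close>, which \<open>exp_span_approx\<close> then replaces by a ridge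
  sum.\<close>

theorem ridge_sums_dense:
  assumes exp: "exp \<in> approximable \<sigma>"
    and K: "compactin (mtopology_of (tensor_metric c d)) K"
    and \<phi>: "continuous_map (subtopology (mtopology_of (tensor_metric c d)) K) euclideanreal \<phi>"
    and e: "0 < e"
  shows "\<exists>g\<in>ridge_sums \<sigma> c d. \<forall>x\<in>K. \<bar>\<phi> x - g x\<bar> < e"
proof -
  have KT: "K \<subseteq> tensors c d"
    using compactin_subset_topspace[OF K] by simp
  have comp: "compact K"
    by (rule compact_tensors[OF K])
  interpret function_ring_on "exp_span c d" K
  proof
    show "(\<lambda>_. u) \<in> exp_span c d" for u
      using exp_span_scaled_exp[of u c d "\<lambda>i m. 0"] by (simp add: lin_def)
    fix x y assume xy: "x \<in> K" "y \<in> K" "x \<noteq> y"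
    have "tensor_dist c d x y \<noteq> 0"
      using Metric_space.zero[OF Metric_space_tensors] xy KT by blast
    then have "\<not> tensor_dist c d x y \<le> 0"
      using tensor_dist_nonneg[of c d x y] by simp
    then obtain i m where im: "i \<in> {1..c}" "m \<in> {1..d}" "x i m \<noteq> y i m"
      by (auto simp: tensor_dist_le_iff)
    \<comment> \<open>These coefficients read off an entry in which \<open>x\<close> and
      \<open>y\<close> differ; the exponential of that entry separates them.\<close>
    define a :: tensor where "a = (\<lambda>i' m'. if i' = i then if m' = m then 1 else 0 else 0)"
    have "(\<Sum>m' = 1..d. a i' m' * z i' m') = (if i' = i then z i m else 0)" for i' z
      using im by (simp add: a_def if_distribR if_distrib[of "\<lambda>u. u * _"] cong: if_cong)
    then have a: "lin c d a z = z i m" for z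
      using im by (simp add: lin_def)
    show "\<exists>f\<in>exp_span c d. f x \<noteq> f y"
      using im(3) by (intro bexI[OF _ exp_span_scaled_exp[of 1 c d a]]) (simp add: a)
  qed (use comp in \<open>auto intro: continuous_on_exp_span exp_span_add exp_span_mult\<close>)
  have "continuous_map (top_of_set K) (subtopology (mtopology_of (tensor_metric c d)) K) (\<lambda>x. x)"
    using continuous_map_into_tensors[OF KT] by (simp add: continuous_map_in_subtopology)
  from continuous_map_compose[OF this \<phi>] have "continuous_on K \<phi>"
    by (simp add: o_def)
  from Stone_Weierstrass_basic[OF this, of "e / 2"] e obtain f where
    f: "f \<in> exp_span c d" "\<And>x. x \<in> K \<Longrightarrow> \<bar>\<phi> x - f x\<bar> < e / 2"
    by auto
  obtain r where r: "\<And>x. x \<in> K \<Longrightarrow> \<forall>i\<in>{1..c}. \<forall>m\<in>{1..d}. \<bar>x i m\<bar> \<le> r"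
    using compact_tensors_bounded[OF comp] by metis
  obtain g where g: "g \<in> ridge_sums \<sigma> c d"
    "\<And>x. \<forall>i\<in>{1..c}. \<forall>m\<in>{1..d}. \<bar>x i m\<bar> \<le> r \<Longrightarrow> \<bar>f x - g x\<bar> < e / 2"
    using exp_span_approx[OF exp f(1), of "e / 2" r] e by auto
  have "\<bar>\<phi> x - g x\<bar> < e" if "x \<in> K" for x
    using f(2)[OF that] g(2)[OF r[OF that]] by linarith
  then show ?thesis
    using g(1) by blast
qed

subsection \<open>Networks of constant hidden width\<close>

text \<open>The zero extension to all integers turns the convolution into a plain sum over
  translates.\<close>

definition pad :: "nat \<Rightarrow> (nat \<Rightarrow> real) \<Rightarrow> int \<Rightarrow> real"
  where "pad d x i = (if i \<in> {1..int d} then x (nat i) else 0)"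

lemma conv_pad:
  "m \<in> {1..d} \<Longrightarrow> conv d k w x m = (\<Sum>l = - int k..int k. w l * pad d x (int m - l))"
  by (simp add: conv_def pad_def)

definition layer :: "nat \<Rightarrow> nat \<Rightarrow> nat \<Rightarrow> nat \<Rightarrow> (nat \<Rightarrow> nat \<Rightarrow> int \<Rightarrow> real) \<Rightarrow> (nat \<Rightarrow> real) \<Rightarrow>
    tensor \<Rightarrow> tensor"
  where "layer d k c c' w \<delta> x =
    (\<lambda>i\<in>{1..c'}. \<lambda>m\<in>{1..d}. (\<Sum>j = 1..c. conv d k (w i j) (x j) m) + \<delta> i)"

lemma conv_layers_layer: "conv_layers d k c c' = {layer d k c c' w \<delta> | w \<delta>. True}"
  unfolding conv_layers_def layer_def[abs_def] by blast

lemma layer_apply: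
  assumes "i \<in> {1..c'}" "m \<in> {1..d}"
  shows "layer d k c c' w \<delta> x i m
    = (\<Sum>l = - int k..int k. \<Sum>j = 1..c. w i j l * pad d (x j) (int m - l)) + \<delta> i"
proof -
  have "layer d k c c' w \<delta> x i m
      = (\<Sum>j = 1..c. \<Sum>l = - int k..int k. w i j l * pad d (x j) (int m - l)) + \<delta> i"
    using assms by (simp add: layer_def conv_pad)
  then show ?thesis
    by (subst (asm) sum.swap)
qed

text \<open>Such maps act separately at each position, as convolutions with kernels supported at 0.
  They merge into a preceding convolution, so inserting them costs no depth.\<close>

definition channel_map :: "nat \<Rightarrow> nat \<Rightarrow> (nat \<Rightarrow> nat) \<Rightarrow> (nat \<Rightarrow> real) \<Rightarrow> (nat \<Rightarrow> real) \<Rightarrow>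
    tensor \<Rightarrow> tensor"
  where "channel_map d c' \<pi> a \<beta> x = (\<lambda>i\<in>{1..c'}. \<lambda>m\<in>{1..d}. a i * x (\<pi> i) m + \<beta> i)"

definition id_kernel :: "int \<Rightarrow> real"
  where "id_kernel l = (if l = 0 then 1 else 0)"

lemma conv_scale: "m \<in> {1..d} \<Longrightarrow> conv d k (\<lambda>l. a * w l) x m = a * conv d k w x m"
  by (simp add: conv_def sum_distrib_left mult.assoc)

lemma conv_kernel_add:
  "m \<in> {1..d} \<Longrightarrow> conv d k (\<lambda>l. v l + w l) x m = conv d k v x m + conv d k w x m"
  by (simp add: conv_pad distrib_right sum.distrib)

lemma conv_zero: "m \<in> {1..d} \<Longrightarrow> conv d k (\<lambda>l. 0) x m = 0"
  by (simp add: conv_pad)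

lemma conv_id_kernel: "m \<in> {1..d} \<Longrightarrow> conv d k id_kernel x m = x m"
  by (simp add: conv_pad id_kernel_def pad_def if_distrib[of "\<lambda>u. u * _"] cong: if_cong)

lemma channel_map_conv_layers:
  assumes "\<And>i. i \<in> {1..c'} \<Longrightarrow> \<pi> i \<in> {1..c}"
  shows "channel_map d c' \<pi> a \<beta> \<in> conv_layers d k c c'"
proof -
  define w :: "nat \<Rightarrow> nat \<Rightarrow> int \<Rightarrow> real"
    where "w i j = (\<lambda>l. (if j = \<pi> i then a i else 0) * id_kernel l)" for i j
  have "channel_map d c' \<pi> a \<beta> x = layer d k c c' w \<beta> x" for x
    unfolding channel_map_def layer_def
  proof (intro restrict_ext)
    fix i m assume im: "i \<in> {1..c'}" "m \<in> {1..d}"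
    have "(\<Sum>j = 1..c. conv d k (w i j) (x j) m) = (\<Sum>j = 1..c. if j = \<pi> i then a i * x j m else 0)"
      unfolding w_def using im(2)
      by (intro sum.cong refl) (simp only: conv_scale conv_id_kernel, simp)
    then show "a i * x (\<pi> i) m + \<beta> i = (\<Sum>j = 1..c. conv d k (w i j) (x j) m) + \<beta> i"
      using assms[OF im(1)] by simp
  qed
  then show ?thesis
    unfolding conv_layers_layer by blast
qed

lemma channel_map_comp_conv_layers:
  assumes "C \<in> conv_layers d k c c'" "\<And>i. i \<in> {1..c''} \<Longrightarrow> \<pi> i \<in> {1..c'}"
  shows "channel_map d c'' \<pi> a \<beta> \<circ> C \<in> conv_layers d k c c''"
proof -
  obtain w \<delta> where C: "C = layer d k c c' w \<delta>"
    using assms(1) unfolding conv_layers_layer by blast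
  have "channel_map d c'' \<pi> a \<beta> (C x)
      = layer d k c c'' (\<lambda>i j l. a i * w (\<pi> i) j l) (\<lambda>i. a i * \<delta> (\<pi> i) + \<beta> i) x" for x
    unfolding channel_map_def layer_def C
    using assms(2) by (intro restrict_ext) (simp add: conv_scale sum_distrib_left distrib_left)
  then show ?thesis
    unfolding conv_layers_layer by (auto simp: fun_eq_iff)
qed

section \<open>Boundedness and uniform continuity on boxes\<close>

definition tensor_box :: "nat \<Rightarrow> nat \<Rightarrow> real \<Rightarrow> tensor set"
  where "tensor_box c d r = {x. \<forall>i\<in>{1..c}. \<forall>m\<in>{1..d}. \<bar>x i m\<bar> \<le> r}"

definition near :: "nat \<Rightarrow> nat \<Rightarrow> real \<Rightarrow> tensor \<Rightarrow> tensor \<Rightarrow> bool"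
  where "near c d e x y \<longleftrightarrow> (\<forall>i\<in>{1..c}. \<forall>m\<in>{1..d}. \<bar>x i m - y i m\<bar> < e)"

text \<open>Boundedness is included so that the property survives composition: the image of a box
  lies in a box on which the next map is uniformly continuous. Entries outside the index ranges are
  ignored by \<open>near\<close> and \<open>tensor_box\<close>.\<close>

definition box_uc :: "nat \<Rightarrow> nat \<Rightarrow> nat \<Rightarrow> (tensor \<Rightarrow> tensor) \<Rightarrow> bool"
  where "box_uc d c c' F \<longleftrightarrow> (\<forall>r. (\<exists>r'. \<forall>x\<in>tensor_box c d r. F x \<in> tensor_box c' d r') \<and>
    (\<forall>e>0. \<exists>\<delta>>0. \<forall>x\<in>tensor_box c d r. \<forall>y\<in>tensor_box c d r. near c d \<delta> x y \<longrightarrow> near c' d e (F x) (F y)))"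

lemma box_ucE_bound:
  assumes "box_uc d c c' F"
  obtains r' where "\<And>x. x \<in> tensor_box c d r \<Longrightarrow> F x \<in> tensor_box c' d r'"
  using assms unfolding box_uc_def by metis

lemma box_ucE:
  assumes "box_uc d c c' F" "0 < e"
  obtains \<delta> where "0 < \<delta>"
    "\<And>x y. x \<in> tensor_box c d r \<Longrightarrow> y \<in> tensor_box c d r \<Longrightarrow> near c d \<delta> x y \<Longrightarrow> near c' d e (F x) (F y)"
  using assms unfolding box_uc_def by metis

lemma near_trans: "near c d e x y \<Longrightarrow> near c d e' y z \<Longrightarrow> near c d (e + e') x z"
  unfolding near_def by (smt (verit))

lemma near_sym: "near c d e x y \<Longrightarrow> near c d e y x"
  unfolding near_def by (simp add: abs_minus_commute)

lemma near_mono: "near c d e x y \<Longrightarrow> e \<le> e' \<Longrightarrow> near c d e' x y"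
  unfolding near_def by force

lemma box_near: "x \<in> tensor_box c d r \<Longrightarrow> near c d e x y \<Longrightarrow> y \<in> tensor_box c d (r + e)"
  unfolding near_def tensor_box_def by (smt (verit) mem_Collect_eq)

lemma box_mono: "r \<le> r' \<Longrightarrow> tensor_box c d r \<subseteq> tensor_box c d r'"
  unfolding tensor_box_def by force

lemma box_uc_comp:
  assumes F: "box_uc d c c' F" and G: "box_uc d c' c'' G"
  shows "box_uc d c c'' (G \<circ> F)"
  unfolding box_uc_def
proof (intro allI conjI impI)
  fix r
  obtain r' where r': "\<And>x. x \<in> tensor_box c d r \<Longrightarrow> F x \<in> tensor_box c' d r'"
    using box_ucE_bound[OF F] by blast
  obtain r'' where r'': "\<And>x. x \<in> tensor_box c' d r' \<Longrightarrow> G x \<in> tensor_box c'' d r''"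
    using box_ucE_bound[OF G] by blast
  show "\<exists>r'. \<forall>x\<in>tensor_box c d r. (G \<circ> F) x \<in> tensor_box c'' d r'"
    using r' r'' by auto
  fix e :: real assume "0 < e"
  from box_ucE[OF G this, of r'] obtain \<delta>' where \<delta>': "0 < \<delta>'"
    "\<And>x y. x \<in> tensor_box c' d r' \<Longrightarrow> y \<in> tensor_box c' d r' \<Longrightarrow> near c' d \<delta>' x y \<Longrightarrow> near c'' d e (G x) (G y)"
    by metis
  from box_ucE[OF F \<delta>'(1), of r] obtain \<delta> where \<delta>: "0 < \<delta>"
    "\<And>x y. x \<in> tensor_box c d r \<Longrightarrow> y \<in> tensor_box c d r \<Longrightarrow> near c d \<delta> x y \<Longrightarrow> near c' d \<delta>' (F x) (F y)"
    by metis
  show "\<exists>\<delta>>0. \<forall>x\<in>tensor_box c d r. \<forall>y\<in>tensor_box c d r. near c d \<delta> x y \<longrightarrow> near c'' d e ((G \<circ> F) x) ((G \<circ> F) y)"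
    using \<delta> \<delta>'(2) r' by (intro exI[of _ \<delta>]) auto
qed

text \<open>A layer is Lipschitz in the maximum norm, with the sum \<open>B\<close> of all absolute
  kernel weights as constant. Boundedness follows by comparison with the zero tensor, whose image is
  the bias.\<close>

lemma box_uc_layer: "box_uc d c c' (layer d k c c' w \<delta>)"
proof -
  define B where "B = (\<Sum>i = 1..c'. \<Sum>l = - int k..int k. \<Sum>j = 1..c. \<bar>w i j l\<bar>)"
  have B0: "0 \<le> B"
    unfolding B_def by (intro sum_nonneg) simp
  have lip: "\<bar>layer d k c c' w \<delta> x i m - layer d k c c' w \<delta> y i m\<bar> \<le> B * s"
    if xy: "\<And>i m. i \<in> {1..c} \<Longrightarrow> m \<in> {1..d} \<Longrightarrow> \<bar>x i m - y i m\<bar> \<le> s" and s: "0 \<le> s"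
      and im: "i \<in> {1..c'}" "m \<in> {1..d}" for x y s i m
  proof -
    have p: "\<bar>pad d (x j) q - pad d (y j) q\<bar> \<le> s" if "j \<in> {1..c}" for j q
      unfolding pad_def using xy[OF that, of "nat q"] s by (auto simp: Suc_le_eq nat_le_iff)
    have "\<bar>layer d k c c' w \<delta> x i m - layer d k c c' w \<delta> y i m\<bar>
        = \<bar>\<Sum>l = - int k..int k. \<Sum>j = 1..c. w i j l * (pad d (x j) (int m - l) - pad d (y j) (int m - l))\<bar>"
      using im by (simp add: layer_apply sum_subtractf right_diff_distrib)
    also have "\<dots> \<le> (\<Sum>l = - int k..int k. \<Sum>j = 1..c. \<bar>w i j l\<bar> * s)"
      by (intro order.trans[OF sum_abs] sum_mono) (simp add: abs_mult mult_left_mono p)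
    also have "\<dots> = (\<Sum>l = - int k..int k. \<Sum>j = 1..c. \<bar>w i j l\<bar>) * s"
      by (simp add: sum_distrib_right)
    also have "\<dots> \<le> B * s"
      unfolding B_def using im(1) s
      by (intro mult_right_mono member_le_sum) (auto intro: sum_nonneg)
    finally show ?thesis .
  qed
  show ?thesis
    unfolding box_uc_def
  proof (intro allI conjI impI)
    fix r :: real
    define M where "M = (\<Sum>i = 1..c'. \<bar>\<delta> i\<bar>)"
    have "layer d k c c' w \<delta> x \<in> tensor_box c' d (M + B * \<bar>r\<bar>)" if x: "x \<in> tensor_box c d r" for x
      unfolding tensor_box_def
    proof (intro CollectI ballI)
      fix i m assume im: "i \<in> {1..c'}" "m \<in> {1..d}"
      have "\<bar>layer d k c c' w \<delta> x i m - layer d k c c' w \<delta> (\<lambda>i m. 0) i m\<bar> \<le> B * \<bar>r\<bar>"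
        using x im by (intro lip) (force simp: tensor_box_def)+
      moreover have "layer d k c c' w \<delta> (\<lambda>i m. 0) i m = \<delta> i"
        using im by (simp add: layer_apply pad_def)
      moreover have "\<bar>\<delta> i\<bar> \<le> M"
        unfolding M_def using im(1) by (intro member_le_sum[of i]) auto
      ultimately show "\<bar>layer d k c c' w \<delta> x i m\<bar> \<le> M + B * \<bar>r\<bar>"
        by linarith
    qed
    then show "\<exists>r'. \<forall>x\<in>tensor_box c d r. layer d k c c' w \<delta> x \<in> tensor_box c' d r'"
      by blast
    fix e :: real assume e: "0 < e"
    have "near c' d e (layer d k c c' w \<delta> x) (layer d k c c' w \<delta> y)" if xy: "near c d (e / (B + 1)) x y" for x y
      unfolding near_def
    proof (intro ballI)
      fix i m assume im: "i \<in> {1..c'}" "m \<in> {1..d}"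
      have "\<bar>layer d k c c' w \<delta> x i m - layer d k c c' w \<delta> y i m\<bar> \<le> B * (e / (B + 1))"
        using xy im e B0 by (intro lip) (auto simp: near_def intro: less_imp_le)
      also have "\<dots> < e"
        using e B0 by (simp add: field_simps)
      finally show "\<bar>layer d k c c' w \<delta> x i m - layer d k c c' w \<delta> y i m\<bar> < e" .
    qed
    moreover have "0 < e / (B + 1)"
      using e B0 by simp
    ultimately show "\<exists>\<delta>'>0. \<forall>x\<in>tensor_box c d r. \<forall>y\<in>tensor_box c d r. near c d \<delta>' x y \<longrightarrow>
        near c' d e (layer d k c c' w \<delta> x) (layer d k c c' w \<delta> y)"
      by blast
  qed
qed

lemma box_uc_conv_layers: "C \<in> conv_layers d k c c' \<Longrightarrow> box_uc d c c' C"
  unfolding conv_layers_layer using box_uc_layer by blast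

lemma continuous_uc_interval:
  fixes f :: "real \<Rightarrow> real"
  assumes "continuous_on UNIV f" "0 < e"
  obtains \<delta> where "0 < \<delta>" "\<And>s t. \<bar>s\<bar> \<le> r \<Longrightarrow> \<bar>t\<bar> \<le> r \<Longrightarrow> \<bar>s - t\<bar> < \<delta> \<Longrightarrow> \<bar>f s - f t\<bar> < e"
proof -
  have "uniformly_continuous_on {-r..r} f"
    by (intro compact_uniformly_continuous continuous_on_subset[OF assms(1)]) auto
  then obtain \<delta> where \<delta>: "0 < \<delta>"
    "\<And>s t. t \<in> {-r..r} \<Longrightarrow> s \<in> {-r..r} \<Longrightarrow> dist s t < \<delta> \<Longrightarrow> dist (f s) (f t) < e"
    unfolding uniformly_continuous_on_def using assms(2) by metis
  show thesis
    by (rule that[OF \<delta>(1)], rule \<delta>(2)[unfolded dist_real_def])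
      (simp_all add: abs_le_iff minus_le_iff)
qed

lemma box_uc_act:
  assumes "continuous_on UNIV \<sigma>"
  shows "box_uc d c c (act \<sigma> c d)"
  unfolding box_uc_def
proof (intro allI conjI impI)
  fix r :: real
  obtain M where M: "\<And>t. \<bar>t\<bar> \<le> r \<Longrightarrow> \<bar>\<sigma> t\<bar> \<le> M"
    using continuous_bounded_interval[OF assms] by metis
  show "\<exists>r'. \<forall>x\<in>tensor_box c d r. act \<sigma> c d x \<in> tensor_box c d r'"
    using M by (intro exI[of _ M]) (auto simp: tensor_box_def act_def)
  fix e :: real assume "0 < e"
  from continuous_uc_interval[OF assms this, of r] obtain \<delta> where \<delta>: "0 < \<delta>"
    "\<And>s t. \<bar>s\<bar> \<le> r \<Longrightarrow> \<bar>t\<bar> \<le> r \<Longrightarrow> \<bar>s - t\<bar> < \<delta> \<Longrightarrow> \<bar>\<sigma> s - \<sigma> t\<bar> < e"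
    by metis
  show "\<exists>\<delta>>0. \<forall>x\<in>tensor_box c d r. \<forall>y\<in>tensor_box c d r. near c d \<delta> x y \<longrightarrow> near c d e (act \<sigma> c d x) (act \<sigma> c d y)"
    using \<delta> by (intro exI[of _ \<delta>]) (simp add: tensor_box_def near_def act_def)
qed

section \<open>Extending networks by layers and blocks\<close>

text \<open>Lets the output width \<open>b (Suc n)\<close> and all later layers be overwritten when
  a network is extended.\<close>

lemma cnn_cong:
  assumes "\<And>i. i \<in> {1..Suc n} \<Longrightarrow> C i = C' i" "\<And>i. i \<in> {1..n} \<Longrightarrow> b i = b' i"
  shows "cnn \<sigma> d b C n = cnn \<sigma> d b' C' n"
  using assms by (induction n) auto

text \<open>Hidden widths equal \<open>L\<close> exactly rather than being bounded by it, so that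
  blocks of width \<open>L\<close> can be chained; \<open>n\<close> counts the activations.\<close>

definition hidden_width_nets ::
    "(real \<Rightarrow> real) \<Rightarrow> nat \<Rightarrow> nat \<Rightarrow> nat \<Rightarrow> nat \<Rightarrow> nat \<Rightarrow> (tensor \<Rightarrow> tensor) set"
  where "hidden_width_nets \<sigma> d k c L c' = {cnn \<sigma> d b C n | n b C.
    b 0 = c \<and> b (Suc n) = c' \<and> (\<forall>i\<in>{1..n}. b i = L) \<and>
    (\<forall>i\<in>{1..Suc n}. C i \<in> conv_layers d k (b (i - 1)) (b i))}"

lemma hidden_width_nets_subset:
  assumes "1 \<le> L"
  shows "hidden_width_nets \<sigma> d k c L c' \<subseteq> deep_narrow_cnns \<sigma> d k c c' L"
proof
  fix f assume "f \<in> hidden_width_nets \<sigma> d k c L c'"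
  then obtain n b C where f: "f = cnn \<sigma> d b C n" "b 0 = c" "b (Suc n) = c'"
    "\<forall>i\<in>{1..n}. b i = L" "\<forall>i\<in>{1..Suc n}. C i \<in> conv_layers d k (b (i - 1)) (b i)"
    unfolding hidden_width_nets_def by blast
  show "f \<in> deep_narrow_cnns \<sigma> d k c c' L"
    unfolding deep_narrow_cnns_def
    using f assms by (intro CollectI exI[of _ "Suc n"] exI[of _ b] exI[of _ C]) auto
qed

lemma hidden_width_nets_conv:
  assumes "C \<in> conv_layers d k c c'"
  shows "C \<in> hidden_width_nets \<sigma> d k c L c'"
  unfolding hidden_width_nets_def using assms
  by (intro CollectI exI[of _ 0] exI[of _ "\<lambda>i. if i = 0 then c else c'"] exI[of _ "\<lambda>i. C"]) auto

text \<open>The channel map is absorbed into the last convolution, so the number of layers does not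
  change.\<close>

lemma hidden_width_nets_channel_map:
  assumes "f \<in> hidden_width_nets \<sigma> d k c L c'" "\<And>i. i \<in> {1..c''} \<Longrightarrow> \<pi> i \<in> {1..c'}"
  shows "channel_map d c'' \<pi> a \<beta> \<circ> f \<in> hidden_width_nets \<sigma> d k c L c''"
proof -
  obtain n b C where f: "f = cnn \<sigma> d b C n" "b 0 = c" "b (Suc n) = c'"
    "\<forall>i\<in>{1..n}. b i = L" "\<forall>i\<in>{1..Suc n}. C i \<in> conv_layers d k (b (i - 1)) (b i)"
    using assms(1) unfolding hidden_width_nets_def by blast
  define C' where "C' = C(Suc n := channel_map d c'' \<pi> a \<beta> \<circ> C (Suc n))"
  define b' where "b' = b(Suc n := c'')"
  have "channel_map d c'' \<pi> a \<beta> \<circ> f = cnn \<sigma> d b' C' n"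
  proof (cases n)
    case 0
    then show ?thesis by (simp add: f(1) C'_def comp_def)
  next
    case (Suc n')
    have "cnn \<sigma> d b' C' n' = cnn \<sigma> d b C n'"
      by (rule cnn_cong) (auto simp: C'_def b'_def Suc)
    then show ?thesis
      by (simp add: f(1) Suc comp_assoc) (simp add: C'_def b'_def Suc comp_assoc)
  qed
  moreover have "C' i \<in> conv_layers d k (b' (i - 1)) (b' i)" if "i \<in> {1..Suc n}" for i
    using f(5)[rule_format, OF that] that f(3) assms(2)
    by (auto simp: C'_def b'_def intro: channel_map_comp_conv_layers)
  moreover have "b' 0 = c" "b' (Suc n) = c''" "\<forall>i\<in>{1..n}. b' i = L"
    using f(2-4) by (auto simp: b'_def)
  ultimately show ?thesis
    unfolding hidden_width_nets_def
    by (intro CollectI exI[of _ n] exI[of _ b'] exI[of _ C']) blast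
qed

text \<open>The former output width becomes a hidden width, which is why \<open>f\<close> ends in
  \<open>L\<close> channels.\<close>

lemma hidden_width_nets_layer:
  assumes "f \<in> hidden_width_nets \<sigma> d k c L L" "D \<in> conv_layers d k L c'"
  shows "D \<circ> act \<sigma> L d \<circ> f \<in> hidden_width_nets \<sigma> d k c L c'"
proof -
  obtain n b C where f: "f = cnn \<sigma> d b C n" "b 0 = c" "b (Suc n) = L"
    "\<forall>i\<in>{1..n}. b i = L" "\<forall>i\<in>{1..Suc n}. C i \<in> conv_layers d k (b (i - 1)) (b i)"
    using assms(1) unfolding hidden_width_nets_def by blast
  define C' where "C' = C(Suc (Suc n) := D)"
  define b' where "b' = b(Suc (Suc n) := c')"
  have "cnn \<sigma> d b' C' n = f"
    unfolding f(1) by (rule cnn_cong) (auto simp: C'_def b'_def)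
  then have "D \<circ> act \<sigma> L d \<circ> f = cnn \<sigma> d b' C' (Suc n)"
    by (simp add: C'_def b'_def f(3))
  moreover have "C' i \<in> conv_layers d k (b' (i - 1)) (b' i)" if "i \<in> {1..Suc (Suc n)}" for i
  proof (cases "i = Suc (Suc n)")
    case True
    then show ?thesis using assms(2) f(3) by (simp add: C'_def b'_def)
  next
    case False
    then show ?thesis using f(5)[rule_format, of i] that by (auto simp: C'_def b'_def)
  qed
  moreover have "b' 0 = c" "b' (Suc (Suc n)) = c'"
    using f(2) by (simp_all add: b'_def)
  moreover have "b' i = L" if "i \<in> {1..Suc n}" for i
    using f(3,4) that by (cases "i = Suc n") (simp_all add: b'_def)
  ultimately show ?thesis
    unfolding hidden_width_nets_def
    by (intro CollectI exI[of _ "Suc n"] exI[of _ b'] exI[of _ C']) simp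
qed

text \<open>A block is a channel map, an activation and a convolution. The channel map scales and
  offsets each channel before the activation; attached to a network it merges into the preceding
  convolution, so chained blocks still alternate convolutions and activations.\<close>

inductive_set block_nets :: "(real \<Rightarrow> real) \<Rightarrow> nat \<Rightarrow> nat \<Rightarrow> nat \<Rightarrow> (tensor \<Rightarrow> tensor) set"
  for \<sigma> d k L
  where
    block_nets_single: "C \<in> conv_layers d k L L \<Longrightarrow>
      C \<circ> act \<sigma> L d \<circ> channel_map d L (\<lambda>i. i) a \<beta> \<in> block_nets \<sigma> d k L"
  | block_nets_step: "C \<in> conv_layers d k L L \<Longrightarrow> G \<in> block_nets \<sigma> d k L \<Longrightarrow>
      C \<circ> act \<sigma> L d \<circ> channel_map d L (\<lambda>i. i) a \<beta> \<circ> G \<in> block_nets \<sigma> d k L"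

lemma block_nets_comp:
  assumes "F \<in> block_nets \<sigma> d k L" "G \<in> block_nets \<sigma> d k L"
  shows "F \<circ> G \<in> block_nets \<sigma> d k L"
  using assms(1)
proof induction
  case (block_nets_single C a \<beta>)
  then show ?case by (rule block_nets_step[OF _ assms(2)])
next
  case (block_nets_step C F a \<beta>)
  from block_nets.block_nets_step[OF this(1,3), of a \<beta>]
  show ?case by (simp only: comp_assoc)
qed

lemma hidden_width_nets_block_nets:
  assumes "G \<in> block_nets \<sigma> d k L" "f \<in> hidden_width_nets \<sigma> d k c L L"
  shows "G \<circ> f \<in> hidden_width_nets \<sigma> d k c L L"
  using assms(1)
proof induction
  case (block_nets_single C a \<beta>)
  from hidden_width_nets_layer[OF hidden_width_nets_channel_map[OF assms(2), of L "\<lambda>i. i" a \<beta>] this]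
  show ?case by (simp only: comp_assoc)
next
  case (block_nets_step C G a \<beta>)
  from hidden_width_nets_layer[OF hidden_width_nets_channel_map[OF block_nets_step(3), of L "\<lambda>i. i" a \<beta>]
      block_nets_step(1)]
  show ?case by (simp only: comp_assoc)
qed

lemma box_uc_block_nets:
  assumes "continuous_on UNIV \<sigma>" "G \<in> block_nets \<sigma> d k L"
  shows "box_uc d L L G"
proof -
  have ch: "box_uc d L L (channel_map d L (\<lambda>i. i) a \<beta>)" for a \<beta>
    by (rule box_uc_conv_layers[OF channel_map_conv_layers]) simp
  show ?thesis
    using assms(2)
  proof induction
    case (block_nets_single C a \<beta>)
    then show ?case
      by (intro box_uc_comp[where c' = L] box_uc_act[OF assms(1)] ch box_uc_conv_layers)
  next
    case (block_nets_step C G a \<beta>)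
    from block_nets_step(1) show ?case
      by (intro box_uc_comp[OF block_nets_step(3)] box_uc_comp[where c' = L] box_uc_act[OF assms(1)] ch box_uc_conv_layers)
  qed
qed

section \<open>Locally uniform limits of block networks\<close>

definition net_approximable ::
    "(real \<Rightarrow> real) \<Rightarrow> nat \<Rightarrow> nat \<Rightarrow> nat \<Rightarrow> (tensor \<Rightarrow> tensor) set"
  where "net_approximable \<sigma> d k L = {F. \<forall>r e. 0 < e \<longrightarrow>
    (\<exists>G\<in>block_nets \<sigma> d k L. \<forall>x\<in>tensor_box L d r. near L d e (G x) (F x))}"

lemma net_approximableD:
  assumes "F \<in> net_approximable \<sigma> d k L" "0 < e"
  obtains G where "G \<in> block_nets \<sigma> d k L" "\<And>x. x \<in> tensor_box L d r \<Longrightarrow> near L d e (G x) (F x)"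
  using assms unfolding net_approximable_def by blast

text \<open>The usual three-part estimate: boundedness and uniform continuity on boxes pass to
  locally uniform limits.\<close>

lemma box_uc_net_approximable:
  assumes \<sigma>: "continuous_on UNIV \<sigma>" and F: "F \<in> net_approximable \<sigma> d k L"
  shows "box_uc d L L F"
  unfolding box_uc_def
proof (intro allI conjI impI)
  fix r :: real
  obtain G where G: "G \<in> block_nets \<sigma> d k L" "\<And>x. x \<in> tensor_box L d r \<Longrightarrow> near L d 1 (G x) (F x)"
    using net_approximableD[OF F, of 1 r] by auto
  obtain r' where "\<And>x. x \<in> tensor_box L d r \<Longrightarrow> G x \<in> tensor_box L d r'"
    using box_ucE_bound[OF box_uc_block_nets[OF \<sigma> G(1)]] by blast
  then show "\<exists>r'. \<forall>x\<in>tensor_box L d r. F x \<in> tensor_box L d r'"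
    using G(2) box_near by blast
  fix e :: real assume "0 < e"
  then have e: "0 < e / 3" by simp
  obtain G where G: "G \<in> block_nets \<sigma> d k L" "\<And>x. x \<in> tensor_box L d r \<Longrightarrow> near L d (e / 3) (G x) (F x)"
    using net_approximableD[OF F e, of r] by auto
  obtain \<delta> where \<delta>: "0 < \<delta>"
    "\<And>x y. x \<in> tensor_box L d r \<Longrightarrow> y \<in> tensor_box L d r \<Longrightarrow> near L d \<delta> x y \<Longrightarrow> near L d (e / 3) (G x) (G y)"
    using box_ucE[OF box_uc_block_nets[OF \<sigma> G(1)] e, of r] by metis
  have "near L d e (F x) (F y)" if xy: "x \<in> tensor_box L d r" "y \<in> tensor_box L d r" "near L d \<delta> x y" for x y
    using near_trans[OF near_trans[OF near_sym[OF G(2)[OF xy(1)]] \<delta>(2)[OF xy]] G(2)[OF xy(2)]]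
    by simp
  then show "\<exists>\<delta>>0. \<forall>x\<in>tensor_box L d r. \<forall>y\<in>tensor_box L d r. near L d \<delta> x y \<longrightarrow> near L d e (F x) (F y)"
    using \<delta>(1) by blast
qed

lemma net_approximable_comp:
  assumes \<sigma>: "continuous_on UNIV \<sigma>"
    and F: "F \<in> net_approximable \<sigma> d k L" and G: "G \<in> net_approximable \<sigma> d k L"
  shows "G \<circ> F \<in> net_approximable \<sigma> d k L"
  unfolding net_approximable_def
proof (intro CollectI allI impI)
  fix r e :: real assume e: "0 < e"
  obtain r' where r': "\<And>x. x \<in> tensor_box L d r \<Longrightarrow> F x \<in> tensor_box L d r'"
    using box_ucE_bound[OF box_uc_net_approximable[OF \<sigma> F]] by blast
  \<comment> \<open>The box is enlarged by 1 because the approximation \<open>F' x\<close> may leave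
    the box that contains \<open>F x\<close>.\<close>
  obtain \<delta> where \<delta>: "0 < \<delta>" "\<And>x y. x \<in> tensor_box L d (r' + 1) \<Longrightarrow> y \<in> tensor_box L d (r' + 1) \<Longrightarrow>
      near L d \<delta> x y \<Longrightarrow> near L d (e / 2) (G x) (G y)"
    using box_ucE[OF box_uc_net_approximable[OF \<sigma> G], of "e / 2" "r' + 1"] e by auto
  obtain F' where F': "F' \<in> block_nets \<sigma> d k L"
    "\<And>x. x \<in> tensor_box L d r \<Longrightarrow> near L d (min \<delta> 1) (F' x) (F x)"
    using net_approximableD[OF F, of "min \<delta> 1" r] \<delta>(1) by auto
  obtain G' where G': "G' \<in> block_nets \<sigma> d k L"
    "\<And>x. x \<in> tensor_box L d (r' + 1) \<Longrightarrow> near L d (e / 2) (G' x) (G x)"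
    using net_approximableD[OF G, of "e / 2" "r' + 1"] e by auto
  have "near L d e ((G' \<circ> F') x) ((G \<circ> F) x)" if x: "x \<in> tensor_box L d r" for x
  proof -
    have n: "near L d (min \<delta> 1) (F' x) (F x)"
      by (rule F'(2)[OF x])
    have b: "F' x \<in> tensor_box L d (r' + 1)"
      using box_near[OF r'[OF x] near_sym[OF n]] box_mono[of "r' + min \<delta> 1" "r' + 1"] by auto
    have b': "F x \<in> tensor_box L d (r' + 1)"
      using r'[OF x] box_mono[of r' "r' + 1"] by auto
    show ?thesis
      using near_trans[OF G'(2)[OF b] \<delta>(2)[OF b b' near_mono[OF n]]] by simp
  qed
  then show "\<exists>H\<in>block_nets \<sigma> d k L. \<forall>x\<in>tensor_box L d r. near L d e (H x) ((G \<circ> F) x)"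
    using block_nets_comp[OF G'(1) F'(1)] by blast
qed

text \<open>The rescaled increment at \<open>\<alpha>\<close> tends to the identity uniformly on
  \<open>[-r, r]\<close> as \<open>h\<close> shrinks. This is how a value passes through an
  activation almost unchanged.\<close>

lemma scaled_increment_tendsto_id:
  assumes der: "(\<sigma> has_real_derivative s) (at \<alpha>)" and s: "s \<noteq> 0" and e: "0 < e"
  obtains h where "0 < h" "\<And>t. \<bar>t\<bar> \<le> r \<Longrightarrow> \<bar>(\<sigma> (h * t + \<alpha>) - \<sigma> \<alpha>) / (h * s) - t\<bar> < e"
proof -
  define R where "R = \<bar>r\<bar> + 1"
  have R: "0 < R" by (simp add: R_def)
  define e' where "e' = e * \<bar>s\<bar> / (2 * R)"
  have e': "0 < e'" using e s R by (simp add: e'_def)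
  have "(\<lambda>u. (\<sigma> (\<alpha> + u) - \<sigma> \<alpha>) / u) \<midarrow>0\<rightarrow> s"
    using der by (simp only: DERIV_def)
  then obtain \<delta> where \<delta>: "0 < \<delta>"
    "\<And>u. u \<noteq> 0 \<Longrightarrow> \<bar>u\<bar> < \<delta> \<Longrightarrow> \<bar>(\<sigma> (\<alpha> + u) - \<sigma> \<alpha>) / u - s\<bar> < e'"
    using e' by (auto simp: LIM_eq)
  define h where "h = \<delta> / (2 * R)"
  have h: "0 < h" using \<delta>(1) R by (simp add: h_def)
  show thesis
  proof (rule that[OF h])
    fix t assume t: "\<bar>t\<bar> \<le> r"
    show "\<bar>(\<sigma> (h * t + \<alpha>) - \<sigma> \<alpha>) / (h * s) - t\<bar> < e"
    proof (cases "t = 0")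
      case False
      have tR: "\<bar>t\<bar> \<le> R" using t by (simp add: R_def)
      then have "\<bar>h * t\<bar> \<le> h * R" using h by (simp add: abs_mult)
      also have "\<dots> < \<delta>" using \<delta>(1) R by (simp add: h_def)
      finally have *: "\<bar>(\<sigma> (\<alpha> + h * t) - \<sigma> \<alpha>) / (h * t) - s\<bar> < e'"
        using False h by (intro \<delta>(2)) auto
      have "(\<sigma> (h * t + \<alpha>) - \<sigma> \<alpha>) / (h * s) - t = ((\<sigma> (\<alpha> + h * t) - \<sigma> \<alpha>) / (h * t) - s) * (t / s)"
        using False h s by (simp add: field_simps)
      also have "\<bar>\<dots>\<bar> \<le> e' * (R / \<bar>s\<bar>)"
        unfolding abs_mult abs_divide using * tR s e'
        by (intro mult_mono divide_right_mono) auto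
      also have "\<dots> < e"
        using e s R by (simp add: e'_def)
      finally show ?thesis .
    qed (use e in simp)
  qed
qed

subsection \<open>Operations on hidden channels\<close>

lemma pad_in: "p \<in> {1..int d} \<Longrightarrow> pad d x p = x (nat p)"
  by (simp add: pad_def)

lemma pad_out: "p \<notin> {1..int d} \<Longrightarrow> pad d x p = 0"
  by (auto simp: pad_def)

text \<open>Specifications are relations, so a step can leave the contents of spare channels
  open.\<close>

definition implementable ::
    "(real \<Rightarrow> real) \<Rightarrow> nat \<Rightarrow> nat \<Rightarrow> nat \<Rightarrow> (tensor \<Rightarrow> tensor \<Rightarrow> bool) \<Rightarrow> bool"
  where "implementable \<sigma> d k L P \<longleftrightarrow> (\<exists>F\<in>net_approximable \<sigma> d k L. \<forall>x. P x (F x))"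

lemma implementable_mono:
  "implementable \<sigma> d k L P \<Longrightarrow> (\<And>x y. P x y \<Longrightarrow> Q x y) \<Longrightarrow> implementable \<sigma> d k L Q"
  unfolding implementable_def by blast

locale activation =
  fixes \<sigma> :: "real \<Rightarrow> real" and \<alpha> s :: real
  assumes continuous: "continuous_on UNIV \<sigma>"
    and derivative: "(\<sigma> has_real_derivative s) (at \<alpha>)"
    and derivative_nonzero: "s \<noteq> 0"
begin

lemma implementable_seq:
  assumes "implementable \<sigma> d k L P" "implementable \<sigma> d k L Q"
    and PQ: "\<And>x y z. P x y \<Longrightarrow> Q y z \<Longrightarrow> R x z"
  shows "implementable \<sigma> d k L R"
proof -
  obtain F where F: "F \<in> net_approximable \<sigma> d k L" "\<And>x. P x (F x)"
    using assms(1) unfolding implementable_def by blast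
  obtain G where G: "G \<in> net_approximable \<sigma> d k L" "\<And>x. Q x (G x)"
    using assms(2) unfolding implementable_def by blast
  show ?thesis
    unfolding implementable_def
    by (rule bexI[OF _ net_approximable_comp[OF continuous F(1) G(1)]])
      (simp add: PQ[OF F(2) G(2)])
qed

text \<open>
  Hidden channels that bypass the activation are carried as \<open>\<sigma> \<alpha> + h s x\<close>.  Because of the
  zero padding the convolution of the offset \<open>\<sigma> \<alpha>\<close> is not constant near the boundary, so no bias
  can remove it; the last channel is spent on the constant \<open>\<sigma> \<alpha>\<close>, which cancels it exactly.
\<close>

lemma layer_net_approximable:
  assumes w: "\<And>i l. w i (Suc n) l = 0" and J: "Suc n \<notin> J"
  shows "(\<lambda>x. layer d k (Suc n) (Suc n) w \<delta> (\<lambda>j. if j \<in> J then (\<lambda>m. \<sigma> (x j m)) else x j))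
    \<in> net_approximable \<sigma> d k (Suc n)"
  unfolding net_approximable_def
proof (intro CollectI allI impI)
  fix r e :: real assume e: "0 < e"
  \<comment> \<open>The channel contents after the activation once offset and scale are removed;
    \<open>\<psi>\<^sub>0\<close> is the limit for small \<open>h\<close>.\<close>
  define \<psi> where "\<psi> h x = (\<lambda>j. if j \<in> J then (\<lambda>m. \<sigma> (x j m))
      else (\<lambda>m. (\<sigma> (h * x j m + \<alpha>) - \<sigma> \<alpha>) / (h * s)))" for h :: real and x :: tensor
  define \<psi>\<^sub>0 where "\<psi>\<^sub>0 x = (\<lambda>j. if j \<in> J then (\<lambda>m. \<sigma> (x j m)) else x j)" for x :: tensor
  obtain M where M: "\<And>t. \<bar>t\<bar> \<le> r \<Longrightarrow> \<bar>\<sigma> t\<bar> \<le> M"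
    using continuous_bounded_interval[OF continuous] by metis
  define R where "R = max M r"
  have box0: "\<psi>\<^sub>0 x \<in> tensor_box (Suc n) d R" if "x \<in> tensor_box (Suc n) d r" for x
    using that M unfolding tensor_box_def \<psi>\<^sub>0_def R_def by (force simp: le_max_iff_disj)
  obtain \<epsilon> where \<epsilon>: "0 < \<epsilon>" "\<And>x y. x \<in> tensor_box (Suc n) d (R + 1) \<Longrightarrow> y \<in> tensor_box (Suc n) d (R + 1) \<Longrightarrow>
      near (Suc n) d \<epsilon> x y \<Longrightarrow>
      near (Suc n) d e (layer d k (Suc n) (Suc n) w \<delta> x) (layer d k (Suc n) (Suc n) w \<delta> y)"
    using box_ucE[OF box_uc_layer e, of "Suc n" d "R + 1" "Suc n" k w \<delta>] by metis
  obtain h where h: "0 < h"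
    "\<And>t. \<bar>t\<bar> \<le> r \<Longrightarrow> \<bar>(\<sigma> (h * t + \<alpha>) - \<sigma> \<alpha>) / (h * s) - t\<bar> < min \<epsilon> 1"
    using scaled_increment_tendsto_id[OF derivative derivative_nonzero, of "min \<epsilon> 1" r] \<epsilon>(1) by auto
  have hs: "h * s \<noteq> 0"
    using h(1) derivative_nonzero by simp
  \<comment> \<open>Channels in \<open>J\<close> enter the activation as they are, the others are
    moved close to \<open>\<alpha>\<close>, and the last one, which is not in \<open>J\<close>,
    becomes the constant \<open>\<alpha>\<close>.\<close>
  define a where "a j = (if j \<in> J then 1 else if j = Suc n then 0 else h)" for j
  define \<beta> where "\<beta> j = (if j \<in> J then 0 else \<alpha>)" for j
  \<comment> \<open>The last column subtracts the offsets \<open>\<sigma> \<alpha>\<close> of all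
    bypassing channels, weighted by their kernels at the same index \<open>l\<close>.\<close>
  define w' where "w' i j l = (if j = Suc n then - (\<Sum>j = 1..n. if j \<in> J then 0 else w i j l / (h * s))
      else if j \<in> J then w i j l else w i j l / (h * s))" for i j and l :: int
  define z where "z x = act \<sigma> (Suc n) d (channel_map d (Suc n) (\<lambda>i. i) a \<beta> x)" for x
  \<comment> \<open>The cancellation happens at every position before summing over the kernel; in
    the padding both sides are 0, so nothing is left over at the boundary.\<close>
  have cancel: "(\<Sum>j = 1..Suc n. w' i j l * pad d (z x j) p) = (\<Sum>j = 1..Suc n. w i j l * pad d (\<psi> h x j) p)"
    for i l x p
  proof (cases "p \<in> {1..int d}")
    case True
    define q where "q = nat p"
    have q: "q \<in> {1..d}" using True by (auto simp: q_def Suc_le_eq nat_le_iff)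
    have z: "z x j q = \<sigma> (a j * x j q + \<beta> j)" if "j \<in> {1..Suc n}" for j
      using that q by (simp add: z_def act_def channel_map_def)
    have "(\<Sum>j = 1..Suc n. w' i j l * z x j q)
        = (\<Sum>j = 1..n. w' i j l * \<sigma> (a j * x j q + \<beta> j)) + w' i (Suc n) l * \<sigma> \<alpha>"
      using J by (simp add: z a_def \<beta>_def)
    also have "\<dots> = (\<Sum>j = 1..n. w' i j l * \<sigma> (a j * x j q + \<beta> j)
        - (if j \<in> J then 0 else w i j l / (h * s)) * \<sigma> \<alpha>)"
      unfolding sum_subtractf sum_distrib_right[symmetric] by (simp add: w'_def)
    also have "\<dots> = (\<Sum>j = 1..n. w i j l * \<psi> h x j q)"
      using hs by (intro sum.cong refl) (auto simp: w'_def a_def \<beta>_def \<psi>_def field_simps)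
    also have "\<dots> = (\<Sum>j = 1..Suc n. w i j l * \<psi> h x j q)"
      by (simp add: w)
    finally show ?thesis
      unfolding pad_in[OF True] q_def .
  qed (simp add: pad_out)
  define G where "G = layer d k (Suc n) (Suc n) w' \<delta> \<circ> act \<sigma> (Suc n) d \<circ> channel_map d (Suc n) (\<lambda>i. i) a \<beta>"
  have "G \<in> block_nets \<sigma> d k (Suc n)"
    unfolding G_def by (rule block_nets_single) (auto simp: conv_layers_layer)
  moreover have "near (Suc n) d e (G x) (layer d k (Suc n) (Suc n) w \<delta> (\<psi>\<^sub>0 x))"
    if x: "x \<in> tensor_box (Suc n) d r" for x
  proof -
    have "G x i m = layer d k (Suc n) (Suc n) w \<delta> (\<psi> h x) i m"
      if "i \<in> {1..Suc n}" "m \<in> {1..d}" for i m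
      unfolding G_def o_def z_def[symmetric] layer_apply[OF that] cancel ..
    moreover have n: "near (Suc n) d (min \<epsilon> 1) (\<psi> h x) (\<psi>\<^sub>0 x)"
      using x h(2) \<epsilon>(1) by (auto simp: near_def \<psi>_def \<psi>\<^sub>0_def tensor_box_def)
    moreover have "\<psi> h x \<in> tensor_box (Suc n) d (R + 1)"
      using box_near[OF box0[OF x] near_mono[OF near_sym[OF n], of 1]] by simp
    moreover have "\<psi>\<^sub>0 x \<in> tensor_box (Suc n) d (R + 1)"
      using box0[OF x] box_mono[of R "R + 1"] by auto
    ultimately have "near (Suc n) d e (layer d k (Suc n) (Suc n) w \<delta> (\<psi> h x))
        (layer d k (Suc n) (Suc n) w \<delta> (\<psi>\<^sub>0 x))"
      using near_mono[OF n, of \<epsilon>] by (intro \<epsilon>(2)) auto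
    then show ?thesis
      using \<open>\<And>m i. i \<in> {1..Suc n} \<Longrightarrow> m \<in> {1..d} \<Longrightarrow> G x i m = _ i m\<close> by (simp add: near_def)
  qed
  ultimately show "\<exists>G\<in>block_nets \<sigma> d k (Suc n). \<forall>x\<in>tensor_box (Suc n) d r. near (Suc n) d e (G x)
      (layer d k (Suc n) (Suc n) w \<delta> (\<lambda>j. if j \<in> J then (\<lambda>m. \<sigma> (x j m)) else x j))"
    unfolding \<psi>\<^sub>0_def by blast
qed

text \<open>The case of \<open>layer_net_approximable\<close> with \<open>J\<close> empty: all
  channels bypass the activation, so an affine update comes out. The kernel \<open>v\<close> will
  later shift the work channel.\<close>

lemma implementable_affine:
  assumes r: "r \<in> {1..n}"
  shows "implementable \<sigma> d k (Suc n) (\<lambda>x y.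
    (\<forall>i\<in>{1..n} - {r}. \<forall>m\<in>{1..d}. y i m = x i m) \<and>
    (\<forall>m\<in>{1..d}. y r m = conv d k v (x r) m + (\<Sum>j = 1..n. c j * x j m) + b))"
proof -
  define w :: "nat \<Rightarrow> nat \<Rightarrow> int \<Rightarrow> real" where
    "w i j = (if j = Suc n then (\<lambda>l. 0)
      else if i = r then (\<lambda>l. c j * id_kernel l + (if j = r then v else (\<lambda>l. 0)) l)
      else if i = j then id_kernel else (\<lambda>l. 0))" for i j
  have L: "layer d k (Suc n) (Suc n) w (\<lambda>i. if i = r then b else 0) x i m
      = (\<Sum>j = 1..n. conv d k (w i j) (x j) m) + (if i = r then b else 0)"
    if "i \<in> {1..n}" "m \<in> {1..d}" for x i m
    using that by (simp add: layer_def w_def conv_zero)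
  have w_r: "(\<Sum>j = 1..n. conv d k (w r j) (x j) m) = conv d k v (x r) m + (\<Sum>j = 1..n. c j * x j m)"
    if "m \<in> {1..d}" for x m
  proof -
    have "conv d k (w r j) (x j) m = c j * x j m + (if j = r then conv d k v (x r) m else 0)"
      if "j \<in> {1..n}" for j
      using that \<open>m \<in> {1..d}\<close>
      by (simp add: w_def conv_kernel_add conv_scale conv_id_kernel conv_zero)
    then show ?thesis
      using r by (simp add: sum.distrib)
  qed
  have w_i: "(\<Sum>j = 1..n. conv d k (w i j) (x j) m) = x i m"
    if "i \<in> {1..n} - {r}" "m \<in> {1..d}" for x i m
  proof -
    have "conv d k (w i j) (x j) m = (if j = i then x j m else 0)" if "j \<in> {1..n}" for j
      using that \<open>i \<in> _\<close> \<open>m \<in> {1..d}\<close> by (simp add: w_def conv_id_kernel conv_zero)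
    then show ?thesis
      using that(1) by simp
  qed
  have "(\<lambda>x. layer d k (Suc n) (Suc n) w (\<lambda>i. if i = r then b else 0) x) \<in> net_approximable \<sigma> d k (Suc n)"
    using layer_net_approximable[of w n "{}" d k "\<lambda>i. if i = r then b else 0"] by (simp add: w_def)
  then show ?thesis
    unfolding implementable_def
    by (rule bexI[rotated]) (use r in \<open>simp add: L w_i w_r del: One_nat_def\<close>)
qed

text \<open>Here \<open>J\<close> contains only \<open>r\<close>, while identity kernels carry the
  other channels past the activation.\<close>

lemma implementable_act:
  assumes r: "r \<in> {1..n}"
  shows "implementable \<sigma> d k (Suc n) (\<lambda>x y.
    (\<forall>i\<in>{1..n} - {r}. \<forall>m\<in>{1..d}. y i m = x i m) \<and> (\<forall>m\<in>{1..d}. y r m = \<sigma> (x r m)))"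
proof -
  define w :: "nat \<Rightarrow> nat \<Rightarrow> int \<Rightarrow> real" where
    "w i j = (if j = i \<and> j \<noteq> Suc n then id_kernel else (\<lambda>l. 0))" for i j
  have L: "layer d k (Suc n) (Suc n) w (\<lambda>i. 0) x i m = x i m" if "i \<in> {1..n}" "m \<in> {1..d}" for x i m
  proof -
    have "conv d k (w i j) (x j) m = (if j = i then x j m else 0)" if "j \<in> {1..Suc n}" for j
      using \<open>i \<in> _\<close> \<open>m \<in> {1..d}\<close> by (auto simp: w_def conv_id_kernel conv_zero)
    then have "(\<Sum>j = 1..Suc n. conv d k (w i j) (x j) m) = (\<Sum>j = 1..Suc n. if j = i then x j m else 0)"
      by (intro sum.cong) auto
    also have "\<dots> = x i m"
      using that(1) by (subst sum.delta) auto
    finally show ?thesis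
      using that by (simp add: layer_def)
  qed
  have "(\<lambda>x. layer d k (Suc n) (Suc n) w (\<lambda>i. 0) (\<lambda>j. if j \<in> {r} then (\<lambda>m. \<sigma> (x j m)) else x j))
      \<in> net_approximable \<sigma> d k (Suc n)"
    using r by (intro layer_net_approximable) (auto simp: w_def)
  then show ?thesis
    unfolding implementable_def
    by (rule bexI[rotated]) (use r in \<open>simp add: L\<close>)
qed

end

section \<open>Memory channels and the work channel\<close>

definition agree :: "nat \<Rightarrow> nat \<Rightarrow> tensor \<Rightarrow> tensor \<Rightarrow> bool"
  where "agree d c x y \<longleftrightarrow> (\<forall>i\<in>{1..c}. \<forall>m\<in>{1..d}. y i m = x i m)"

lemma agree_trans: "agree d c x y \<Longrightarrow> agree d c y z \<Longrightarrow> agree d c x z"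
  by (simp add: agree_def)

lemma agreeD: "agree d c x y \<Longrightarrow> i \<in> {1..c} \<Longrightarrow> m \<in> {1..d} \<Longrightarrow> y i m = x i m"
  by (simp add: agree_def)

lemma conv_shift:
  assumes "m \<in> {1..d}" "p \<in> {- int k..int k}"
  shows "conv d k (\<lambda>l. if l = p then 1 else 0) x m = pad d x (int m - p)"
  using assms by (simp add: conv_pad if_distrib[of "\<lambda>u. u * _"] cong: if_cong)

lemma lin_agree: "agree d c x y \<Longrightarrow> lin c d a y = lin c d a x"
  unfolding lin_def by (intro sum.cong refl) (simp add: agreeD)

text \<open>Ridge sums read only the input channels, so they can be evaluated after the accumulators
  have changed.\<close>

lemma ridge_sums_agree:
  assumes "f \<in> ridge_sums \<sigma> c d" "agree d c x y"
  shows "f y = f x"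
  using assms(1) by induction (simp_all add: lin_agree[OF assms(2)])

context activation
begin

text \<open>Fixes the layout: channels \<open>1\<close> to \<open>B\<close> are memory,
  \<open>Suc B\<close> is the work channel, and \<open>Suc (Suc B)\<close> carries the
  constant.\<close>

lemma implementable_work:
  "implementable \<sigma> d k (Suc (Suc B)) (\<lambda>x y. agree d B x y \<and>
    (\<forall>m\<in>{1..d}. y (Suc B) m = conv d k v (x (Suc B)) m + (\<Sum>j = 1..Suc B. c j * x j m) + b))"
proof (rule implementable_mono[OF implementable_affine[of "Suc B" "Suc B" d k v c b]])
  have "{1..Suc B} - {Suc B} = {1..B}" by auto
  then show "agree d B x y \<and> (\<forall>m\<in>{1..d}. y (Suc B) m
      = conv d k v (x (Suc B)) m + (\<Sum>j = 1..Suc B. c j * x j m) + b)"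
    if "(\<forall>i\<in>{1..Suc B} - {Suc B}. \<forall>m\<in>{1..d}. y i m = x i m) \<and> (\<forall>m\<in>{1..d}. y (Suc B) m
      = conv d k v (x (Suc B)) m + (\<Sum>j = 1..Suc B. c j * x j m) + b)" for x y
    using that by (simp only: agree_def)
qed simp

text \<open>
  Horner scheme in the shift operator: each step moves the work channel one position towards the
  boundary and adds one column of \<open>a\<close>, so that entry 1 collects the whole linear form.
\<close>

lemma implementable_load_partial:
  assumes k: "1 \<le> k" and c: "c \<le> B" and n: "n \<le> d"
  shows "implementable \<sigma> d k (Suc (Suc B)) (\<lambda>x y. agree d B x y \<and> (\<forall>m\<in>{1..d}. y (Suc B) m
    = (\<Sum>i<n. \<Sum>j = 1..c. a j (d - n + 1 + i) * (if m + i \<le> d then x j (m + i) else 0))))"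
  using n
proof (induction n)
  case 0
  show ?case
    by (rule implementable_mono[OF implementable_work[of d k B "\<lambda>l. 0" "\<lambda>j. 0" 0]])
      (simp add: conv_zero)
next
  case (Suc n)
  \<comment> \<open>The kernel supported at \<open>- 1\<close> makes entry \<open>m\<close> read
    entry \<open>m + 1\<close>. Columns enter from \<open>d\<close> downwards, so column
    \<open>d - n\<close> comes next and undergoes all remaining shifts.\<close>
  show ?case
  proof (rule implementable_seq[OF Suc.IH implementable_work[of d k B "\<lambda>l. if l = - 1 then 1 else 0"
          "\<lambda>j. if j \<le> c then a j (d - n) else 0" 0]])
    show "n \<le> d" using Suc.prems by simp
    fix x y z
    assume xy: "agree d B x y \<and> (\<forall>m\<in>{1..d}. y (Suc B) m
        = (\<Sum>i<n. \<Sum>j = 1..c. a j (d - n + 1 + i) * (if m + i \<le> d then x j (m + i) else 0)))"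
      and yz: "agree d B y z \<and> (\<forall>m\<in>{1..d}. z (Suc B) m
        = conv d k (\<lambda>l. if l = - 1 then 1 else 0) (y (Suc B)) m
          + (\<Sum>j = 1..Suc B. (if j \<le> c then a j (d - n) else 0) * y j m) + 0)"
    have "z (Suc B) m = (\<Sum>i<Suc n. \<Sum>j = 1..c. a j (d - Suc n + 1 + i) *
        (if m + i \<le> d then x j (m + i) else 0))" if m: "m \<in> {1..d}" for m
    proof -
      have "(\<Sum>j = 1..Suc B. (if j \<le> c then a j (d - n) else 0) * y j m) = (\<Sum>j = 1..c. a j (d - n) * y j m)"
        using c by (intro sum.mono_neutral_cong_right) auto
      also have "\<dots> = (\<Sum>j = 1..c. a j (d - n) * x j m)"
        using xy c m by (intro sum.cong refl) (auto simp: agree_def)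
      also have "\<dots> = (\<Sum>j = 1..c. a j (d - Suc n + 1 + 0) * (if m + 0 \<le> d then x j (m + 0) else 0))"
        using m Suc.prems by (simp add: Suc_diff_Suc)
      finally have col: "(\<Sum>j = 1..Suc B. (if j \<le> c then a j (d - n) else 0) * y j m) = \<dots>" .
      have "conv d k (\<lambda>l. if l = - 1 then 1 else 0) (y (Suc B)) m = pad d (y (Suc B)) (int (Suc m))"
        using m k by (simp add: conv_shift add.commute)
      also have "\<dots> = (\<Sum>i<n. \<Sum>j = 1..c. a j (d - n + 1 + i) *
          (if Suc m + i \<le> d then x j (Suc m + i) else 0))"
        using m xy by (cases "m < d") (auto simp: pad_def nat_add_distrib simp del: One_nat_def)
      also have "\<dots> = (\<Sum>i<n. \<Sum>j = 1..c. a j (d - Suc n + 1 + Suc i) *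
          (if m + Suc i \<le> d then x j (m + Suc i) else 0))"
        using Suc.prems by (simp add: Suc_diff_Suc cong: if_cong)
      finally have shift: "conv d k (\<lambda>l. if l = - 1 then 1 else 0) (y (Suc B)) m = \<dots>" .
      show ?thesis
        using yz m unfolding sum.lessThan_Suc_shift by (simp only: shift col)
    qed
    then show "agree d B x z \<and> (\<forall>m\<in>{1..d}. z (Suc B) m = (\<Sum>i<Suc n. \<Sum>j = 1..c.
        a j (d - Suc n + 1 + i) * (if m + i \<le> d then x j (m + i) else 0)))"
      using xy yz agree_trans by blast
  qed
qed

text \<open>After all \<open>d\<close> Horner steps entry 1 sees every column untruncated, since
  \<open>1 + i \<le> d\<close> for \<open>i < d\<close>. The other entries are left open.\<close>

lemma implementable_load:
  assumes "1 \<le> k" "c \<le> B" and d: "1 \<le> d"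
  shows "implementable \<sigma> d k (Suc (Suc B)) (\<lambda>x y. agree d B x y \<and> y (Suc B) 1 = lin c d a x)"
proof (rule implementable_mono[OF implementable_load_partial[OF assms(1,2) order.refl, of d a]])
  have "(\<Sum>i<d. \<Sum>j = 1..c. a j (d - d + 1 + i) * (if 1 + i \<le> d then x j (1 + i) else 0)) = lin c d a x" for x
  proof -
    have "lin c d a x = (\<Sum>m = 1..d. \<Sum>j = 1..c. a j m * x j m)"
      unfolding lin_def by (rule sum.swap)
    also have "\<dots> = (\<Sum>i<d. \<Sum>j = 1..c. a j (1 + i) * x j (1 + i))"
      by (simp add: sum.atLeast1_atMost_eq)
    also have "\<dots> = (\<Sum>i<d. \<Sum>j = 1..c. a j (d - d + 1 + i) * (if 1 + i \<le> d then x j (1 + i) else 0))"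
      by (intro sum.cong refl) simp
    finally show ?thesis ..
  qed
  then show "agree d B x y \<and> y (Suc B) 1 = lin c d a x"
    if "agree d B x y \<and> (\<forall>m\<in>{1..d}. y (Suc B) m
      = (\<Sum>i<d. \<Sum>j = 1..c. a j (d - d + 1 + i) * (if m + i \<le> d then x j (m + i) else 0)))" for x y
    using that d by force
qed

lemma implementable_comps:
  assumes "g \<in> comps \<sigma>"
  shows "implementable \<sigma> d k (Suc (Suc B))
    (\<lambda>x y. agree d B x y \<and> (\<forall>m\<in>{1..d}. y (Suc B) m = g (x (Suc B) m)))"
proof -
  have aff: "implementable \<sigma> d k (Suc (Suc B))
    (\<lambda>x y. agree d B x y \<and> (\<forall>m\<in>{1..d}. y (Suc B) m = w * x (Suc B) m + b))" for w b
  proof (rule implementable_mono[OF implementable_work[of d k B "\<lambda>l. 0" "\<lambda>j. if j = Suc B then w else 0" b]])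
    have "(\<Sum>j = 1..Suc B. (if j = Suc B then w else 0) * x j m) = w * x (Suc B) m" for x :: tensor and m
      by simp
    then show "agree d B x y \<and> (\<forall>m\<in>{1..d}. y (Suc B) m = w * x (Suc B) m + b)"
      if "agree d B x y \<and> (\<forall>m\<in>{1..d}. y (Suc B) m = conv d k (\<lambda>l. 0) (x (Suc B)) m
        + (\<Sum>j = 1..Suc B. (if j = Suc B then w else 0) * x j m) + b)" for x y
      using that by (simp add: conv_zero)
  qed
  have act: "implementable \<sigma> d k (Suc (Suc B))
    (\<lambda>x y. agree d B x y \<and> (\<forall>m\<in>{1..d}. y (Suc B) m = \<sigma> (x (Suc B) m)))"
    by (rule implementable_mono[OF implementable_act[of "Suc B" "Suc B"]]) (auto simp: agree_def)
  show ?thesis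
    using assms
  proof induction
    case (comps_affine w b)
    show ?case by (rule aff)
  next
    case (comps_step g w b)
    have "implementable \<sigma> d k (Suc (Suc B))
        (\<lambda>x y. agree d B x y \<and> (\<forall>m\<in>{1..d}. y (Suc B) m = w * \<sigma> (x (Suc B) m) + b))"
      by (rule implementable_seq[OF act aff[of w b]]) (auto simp: agree_def)
    then show ?case
      by (rule implementable_seq[OF comps_step.IH]) (auto simp: agree_def)
  qed
qed

text \<open>Iterates the shift by one position, which fits into the kernel since
  \<open>k \<ge> 1\<close>. Entries pushed over the boundary are replaced by the zero
  padding.\<close>

lemma implementable_shift:
  assumes k: "1 \<le> k" and p: "p = 1 \<or> p = - 1"
  shows "implementable \<sigma> d k (Suc (Suc B))
    (\<lambda>x y. agree d B x y \<and> (\<forall>m\<in>{1..d}. y (Suc B) m = pad d (x (Suc B)) (int m - int n * p)))"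
proof (induction n)
  case 0
  show ?case
    by (rule implementable_mono[OF implementable_comps[OF comps_affine[of 1 0]]]) (simp add: pad_def)
next
  case (Suc n)
  show ?case
  proof (rule implementable_seq[OF Suc.IH implementable_work[of d k B "\<lambda>l. if l = p then 1 else 0" "\<lambda>j. 0" 0]],
      intro conjI ballI)
    fix x y z :: tensor
    assume xy: "agree d B x y \<and> (\<forall>m\<in>{1..d}. y (Suc B) m = pad d (x (Suc B)) (int m - int n * p))"
      and yz: "agree d B y z \<and> (\<forall>m\<in>{1..d}. z (Suc B) m = conv d k (\<lambda>l. if l = p then 1 else 0) (y (Suc B)) m
        + (\<Sum>j = 1..Suc B. 0 * y j m) + 0)"
    then show "agree d B x z"
      using agree_trans by blast
    fix m assume m: "m \<in> {1..d}"
    have "z (Suc B) m = pad d (y (Suc B)) (int m - p)"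
      using yz m p k by (auto simp: conv_shift)
    also have "\<dots> = pad d (x (Suc B)) (int m - int (Suc n) * p)"
    proof (cases "int m - p \<in> {1..int d}")
      case True
      then have "nat (int m - p) \<in> {1..d}"
        by (auto simp: Suc_le_eq nat_le_iff)
      with xy have "y (Suc B) (nat (int m - p)) = pad d (x (Suc B)) (int (nat (int m - p)) - int n * p)"
        by blast
      then show ?thesis
        using True by (simp add: pad_in algebra_simps)
    next
      \<comment> \<open>A position outside the range stays outside under further shifts in the same
        direction, so both sides are 0.\<close>
      case False
      then have "int m - int (Suc n) * p \<notin> {1..int d}"
        using m p by auto
      then show ?thesis
        using False by (metis pad_out)
    qed
    finally show "z (Suc B) m = pad d (x (Suc B)) (int m - int (Suc n) * p)" .
  qed
qed

text \<open>Shifting by \<open>d - 1\<close> towards higher positions leaves only entry 1, now at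
  position \<open>d\<close>, and zeros elsewhere; shifting back by \<open>d - p\<close> puts it at
  \<open>p\<close>.\<close>

lemma implementable_move:
  assumes k: "1 \<le> k" and p: "p \<in> {1..d}"
  shows "implementable \<sigma> d k (Suc (Suc B))
    (\<lambda>x y. agree d B x y \<and> (\<forall>m\<in>{1..d}. y (Suc B) m = (if m = p then x (Suc B) 1 else 0)))"
proof (rule implementable_seq[OF implementable_shift[OF k, of 1 d B "d - 1"]
      implementable_shift[OF k, of "- 1" d B "d - p"]], simp_all only: refl simp_thms)
  fix x y z :: tensor
  assume xy: "agree d B x y \<and> (\<forall>m\<in>{1..d}. y (Suc B) m = pad d (x (Suc B)) (int m - int (d - 1) * 1))"
    and yz: "agree d B y z \<and> (\<forall>m\<in>{1..d}. z (Suc B) m = pad d (y (Suc B)) (int m - int (d - p) * - 1))"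
  have y: "y (Suc B) m = (if m = d then x (Suc B) 1 else 0)" if "m \<in> {1..d}" for m
    using xy that by (auto simp: pad_def of_nat_diff)
  have "z (Suc B) m = (if m = p then x (Suc B) 1 else 0)" if m: "m \<in> {1..d}" for m
  proof -
    have "z (Suc B) m = pad d (y (Suc B)) (int (m + (d - p)))"
      using yz m by simp
    also have "\<dots> = (if m + (d - p) \<le> d then y (Suc B) (m + (d - p)) else 0)"
      using m by (simp add: pad_def flip: of_nat_add)
    also have "\<dots> = (if m = p then x (Suc B) 1 else 0)"
      using m p by (auto simp: y)
    finally show ?thesis .
  qed
  then show "agree d B x z \<and> (\<forall>m\<in>{1..d}. z (Suc B) m = (if m = p then x (Suc B) 1 else 0))"
    using xy yz agree_trans by blast
qed

lemma implementable_accumulate: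
  assumes i: "i \<in> {1..B}"
  shows "implementable \<sigma> d k (Suc (Suc B)) (\<lambda>x y. \<forall>i'\<in>{1..B}. \<forall>m\<in>{1..d}.
    y i' m = x i' m + (if i' = i then x (Suc B) m else 0))"
proof (rule implementable_mono[OF implementable_affine[of i "Suc B" d k "\<lambda>l. 0"
        "\<lambda>j. if j = i \<or> j = Suc B then 1 else 0" 0]])
  show "i \<in> {1..Suc B}" using i by simp
  have "(\<Sum>j = 1..Suc B. (if j = i \<or> j = Suc B then 1 else 0) * x j m) = x i m + x (Suc B) m" for x :: tensor and m
  proof -
    have "(\<Sum>j = 1..Suc B. (if j = i \<or> j = Suc B then 1 else 0) * x j m) = (\<Sum>j\<in>{i, Suc B}. x j m)"
      using i by (intro sum.mono_neutral_cong_right) auto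
    then show ?thesis using i by simp
  qed
  then show "\<forall>i'\<in>{1..B}. \<forall>m\<in>{1..d}. y i' m = x i' m + (if i' = i then x (Suc B) m else 0)"
    if "(\<forall>i'\<in>{1..Suc B} - {i}. \<forall>m\<in>{1..d}. y i' m = x i' m) \<and> (\<forall>m\<in>{1..d}. y i m
      = conv d k (\<lambda>l. 0) (x i) m + (\<Sum>j = 1..Suc B. (if j = i \<or> j = Suc B then 1 else 0) * x j m) + 0)"
    for x y :: tensor
    using that by (auto simp: conv_zero)
qed

text \<open>Load the linear form into entry 1, apply \<open>g\<close>, clear the other entries while
  moving to position \<open>p\<close>, and add to channel \<open>i\<close>. The obligations compose
  these specifications from the last stage backwards.\<close>

lemma implementable_ridge:
  assumes k: "1 \<le> k" and c: "c \<le> B" and i: "i \<in> {1..B}" and p: "p \<in> {1..d}" and g: "g \<in> comps \<sigma>"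
  shows "implementable \<sigma> d k (Suc (Suc B)) (\<lambda>x y. \<forall>i'\<in>{1..B}. \<forall>m\<in>{1..d}.
    y i' m = x i' m + (if i' = i \<and> m = p then g (lin c d a x) else 0))"
proof (rule implementable_seq[OF implementable_load[OF k c] implementable_seq[OF implementable_comps[OF g]
        implementable_seq[OF implementable_move[OF k p] implementable_accumulate[OF i]]]])
  show d: "1 \<le> d" using p by auto
  show "(\<forall>i'\<in>{1..B}. \<forall>m\<in>{1..d}. z i' m = x i' m + (if i' = i \<and> m = p then x (Suc B) 1 else 0))"
    if "agree d B x y \<and> (\<forall>m\<in>{1..d}. y (Suc B) m = (if m = p then x (Suc B) 1 else 0))"
      "\<forall>i'\<in>{1..B}. \<forall>m\<in>{1..d}. z i' m = y i' m + (if i' = i then y (Suc B) m else 0)" for x y z :: tensor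
    using that by (simp add: agree_def)
  show "(\<forall>i'\<in>{1..B}. \<forall>m\<in>{1..d}. z i' m = x i' m + (if i' = i \<and> m = p then g (x (Suc B) 1) else 0))"
    if "agree d B x y \<and> (\<forall>m\<in>{1..d}. y (Suc B) m = g (x (Suc B) m))"
      "\<forall>i'\<in>{1..B}. \<forall>m\<in>{1..d}. z i' m = y i' m + (if i' = i \<and> m = p then y (Suc B) 1 else 0)" for x y z :: tensor
    using that d by (simp add: agree_def)
  show "\<forall>i'\<in>{1..B}. \<forall>m\<in>{1..d}. z i' m = x i' m + (if i' = i \<and> m = p then g (lin c d a x) else 0)"
    if "agree d B x y \<and> y (Suc B) 1 = lin c d a x"
      "\<forall>i'\<in>{1..B}. \<forall>m\<in>{1..d}. z i' m = y i' m + (if i' = i \<and> m = p then g (y (Suc B) 1) else 0)" for x y z :: tensor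
    using that by (simp add: agree_def)
qed

text \<open>Since \<open>c < i\<close>, the accumulator is not an input channel, so every summand is
  evaluated on the original input.\<close>

lemma implementable_ridge_sum:
  assumes k: "1 \<le> k" and c: "c < i" and i: "i \<in> {1..B}" and p: "p \<in> {1..d}"
    and f: "f \<in> ridge_sums \<sigma> c d"
  shows "implementable \<sigma> d k (Suc (Suc B)) (\<lambda>x y. \<forall>i'\<in>{1..B}. \<forall>m\<in>{1..d}.
    y i' m = x i' m + (if i' = i \<and> m = p then f x else 0))"
  using f
proof induction
  case ridge_sums_zero
  show ?case
    by (rule implementable_mono[OF implementable_comps[OF comps_affine[of 1 0]]]) (simp add: agree_def)
next
  case (ridge_sums_add f g a)
  have "c \<le> B" using c i by simp
  show ?case
  proof (rule implementable_seq[OF ridge_sums_add.IH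
        implementable_ridge[OF k \<open>c \<le> B\<close> i p ridge_sums_add.hyps(2), of a]])
    fix x y z :: tensor
    assume xy: "\<forall>i'\<in>{1..B}. \<forall>m\<in>{1..d}. y i' m = x i' m + (if i' = i \<and> m = p then f x else 0)"
      and yz: "\<forall>i'\<in>{1..B}. \<forall>m\<in>{1..d}. z i' m = y i' m + (if i' = i \<and> m = p then g (lin c d a y) else 0)"
    have "agree d c x y"
      using xy c i by (auto simp: agree_def)
    then show "\<forall>i'\<in>{1..B}. \<forall>m\<in>{1..d}. z i' m = x i' m + (if i' = i \<and> m = p then f x + g (lin c d a x) else 0)"
      using xy yz by (simp add: lin_agree)
  qed
qed

text \<open>Induction over the set of output entries already served; entry \<open>(j, m)\<close> is
  accumulated in channel \<open>c + j\<close>.\<close>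

lemma implementable_ridge_sum_family:
  assumes k: "1 \<le> k" and S: "finite S" "S \<subseteq> {1..c'} \<times> {1..d}"
    and f: "\<And>j m. j \<in> {1..c'} \<Longrightarrow> m \<in> {1..d} \<Longrightarrow> f j m \<in> ridge_sums \<sigma> c d"
  shows "implementable \<sigma> d k (Suc (Suc (c + c'))) (\<lambda>x y. \<forall>i\<in>{1..c + c'}. \<forall>m\<in>{1..d}.
    y i m = x i m + (if c < i \<and> (i - c, m) \<in> S then f (i - c) m x else 0))"
  using S
proof (induction S rule: finite_induct)
  case empty
  show ?case
    by (rule implementable_mono[OF implementable_comps[OF comps_affine[of 1 0]]]) (simp add: agree_def)
next
  case (insert q S)
  obtain j p where q: "q = (j, p)" and jp: "j \<in> {1..c'}" "p \<in> {1..d}"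
    using insert.prems by auto
  have S: "S \<subseteq> {1..c'} \<times> {1..d}" using insert.prems by simp
  have i: "c < c + j" "c + j \<in> {1..c + c'}" using jp by auto
  show ?case
  proof (rule implementable_seq[OF insert.IH[OF S] implementable_ridge_sum[OF k i jp(2) f[OF jp]]])
    fix x y z :: tensor
    assume xy: "\<forall>i\<in>{1..c + c'}. \<forall>m\<in>{1..d}.
        y i m = x i m + (if c < i \<and> (i - c, m) \<in> S then f (i - c) m x else 0)"
      and yz: "\<forall>i\<in>{1..c + c'}. \<forall>m\<in>{1..d}. z i m = y i m + (if i = c + j \<and> m = p then f j p y else 0)"
    have "agree d c x y"
      using xy by (simp add: agree_def)
    then have fy: "f j p y = f j p x"
      by (rule ridge_sums_agree[OF f[OF jp]])
    show "\<forall>i\<in>{1..c + c'}. \<forall>m\<in>{1..d}.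
        z i m = x i m + (if c < i \<and> (i - c, m) \<in> insert q S then f (i - c) m x else 0)"
    proof (intro ballI)
      fix i m assume im: "i \<in> {1..c + c'}" "m \<in> {1..d}"
      show "z i m = x i m + (if c < i \<and> (i - c, m) \<in> insert q S then f (i - c) m x else 0)"
        using yz[rule_format, OF im] xy[rule_format, OF im] insert.hyps(2) jp(1)
        by (auto simp: q fy)
    qed
  qed
qed

text \<open>The embedding \<open>E\<close> of the input starts the network, and the projection
  \<open>P\<close> onto the accumulators is absorbed into the last convolution, so every hidden
  layer has \<open>c + c' + 2\<close> channels.\<close>

theorem ridge_sum_cnn:
  assumes k: "1 \<le> k" and c: "1 \<le> c" and e: "0 < e"
    and f: "\<And>j m. j \<in> {1..c'} \<Longrightarrow> m \<in> {1..d} \<Longrightarrow> f j m \<in> ridge_sums \<sigma> c d"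
  obtains g where "g \<in> deep_narrow_cnns \<sigma> d k c c' (c + c' + 2)" "box_uc d c c' g"
    "\<And>x. g x \<in> tensors c' d"
    "\<And>x j m. x \<in> tensor_box c d r \<Longrightarrow> j \<in> {1..c'} \<Longrightarrow> m \<in> {1..d} \<Longrightarrow> \<bar>g x j m - f j m x\<bar> < e"
proof -
  define L where "L = Suc (Suc (c + c'))"
  have "implementable \<sigma> d k L (\<lambda>x y. \<forall>i\<in>{1..c + c'}. \<forall>m\<in>{1..d}. y i m
      = x i m + (if c < i \<and> (i - c, m) \<in> {1..c'} \<times> {1..d} then f (i - c) m x else 0))"
    unfolding L_def by (rule implementable_ridge_sum_family[OF k _ order.refl f]) simp_all
  then obtain F where F: "F \<in> net_approximable \<sigma> d k L" "\<And>x. \<forall>i\<in>{1..c + c'}. \<forall>m\<in>{1..d}. F x i m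
      = x i m + (if c < i \<and> (i - c, m) \<in> {1..c'} \<times> {1..d} then f (i - c) m x else 0)"
    unfolding implementable_def by blast
  \<comment> \<open>Channels beyond \<open>c\<close> nominally read channel 1 with factor 0;
    \<open>1 \<le> c\<close> guarantees that this channel exists.\<close>
  define E where "E = channel_map d L (\<lambda>i. if i \<le> c then i else 1) (\<lambda>i. if i \<le> c then 1 else 0) (\<lambda>i. 0)"
  define P where "P = channel_map d c' (\<lambda>j. c + j) (\<lambda>i. 1) (\<lambda>i. 0)"
  \<comment> \<open>The radius is \<open>\<bar>r\<bar>\<close> because \<open>E x\<close> also has
    zero entries, which need a nonnegative bound.\<close>
  obtain G where G: "G \<in> block_nets \<sigma> d k L" "\<And>x. x \<in> tensor_box L d \<bar>r\<bar> \<Longrightarrow> near L d e (G x) (F x)"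
    using net_approximableD[OF F(1) e, of "\<bar>r\<bar>"] by metis
  have E: "E \<in> conv_layers d k c L"
    unfolding E_def using c by (intro channel_map_conv_layers) auto
  have P: "P \<in> conv_layers d k L c'"
    unfolding P_def by (intro channel_map_conv_layers) (auto simp: L_def)
  show thesis
  proof (rule that[of "P \<circ> (G \<circ> E)"])
    have "G \<circ> E \<in> hidden_width_nets \<sigma> d k c L L"
      by (rule hidden_width_nets_block_nets[OF G(1) hidden_width_nets_conv[OF E]])
    then have "P \<circ> (G \<circ> E) \<in> hidden_width_nets \<sigma> d k c L c'"
      unfolding P_def by (rule hidden_width_nets_channel_map) (auto simp: L_def)
    then show "P \<circ> (G \<circ> E) \<in> deep_narrow_cnns \<sigma> d k c c' (c + c' + 2)"
      using hidden_width_nets_subset[of L \<sigma> d k c c'] by (auto simp: L_def)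
    show "box_uc d c c' (P \<circ> (G \<circ> E))"
      by (intro box_uc_comp[where c' = L] box_uc_conv_layers[OF E] box_uc_conv_layers[OF P]
          box_uc_block_nets[OF continuous G(1)])
    show "(P \<circ> (G \<circ> E)) x \<in> tensors c' d" for x
      by (auto simp: P_def channel_map_def tensors_def)
    fix x j m assume x: "x \<in> tensor_box c d r" and jm: "j \<in> {1..c'}" "m \<in> {1..d}"
    have Ex: "E x i q = (if i \<le> c then x i q else 0)" if "i \<in> {1..L}" "q \<in> {1..d}" for i q
      using that by (simp add: E_def channel_map_def)
    have "E x \<in> tensor_box L d \<bar>r\<bar>"
      unfolding tensor_box_def
    proof (intro CollectI ballI)
      fix i q assume iq: "i \<in> {1..L}" "q \<in> {1..d}"
      then have "\<bar>x i q\<bar> \<le> r" if "i \<le> c"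
        using x that by (simp add: tensor_box_def)
      then show "\<bar>E x i q\<bar> \<le> \<bar>r\<bar>"
        by (auto simp: Ex[OF iq])
    qed
    from G(2)[OF this] have "\<bar>G (E x) (c + j) m - F (E x) (c + j) m\<bar> < e"
      using jm unfolding near_def L_def by auto
    moreover have "agree d c x (E x)"
      by (auto simp: agree_def Ex L_def)
    then have "f j m (E x) = f j m x"
      by (rule ridge_sums_agree[OF f[OF jm]])
    moreover have "F (E x) (c + j) m = E x (c + j) m + f j m (E x)"
      using F(2)[of "E x"] jm by auto
    \<comment> \<open>The accumulators start at 0, so the output channels of \<open>F\<close> hold
      exactly the ridge sums.\<close>
    moreover have "E x (c + j) m = 0"
      using jm Ex[of "c + j" m] by (auto simp: L_def)
    moreover have "(P \<circ> (G \<circ> E)) x j m = G (E x) (c + j) m"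
      using jm by (simp add: P_def channel_map_def)
    ultimately show "\<bar>(P \<circ> (G \<circ> E)) x j m - f j m x\<bar> < e"
      by simp
  qed
qed

end

section \<open>Closure in the space of continuous functions\<close>

lemma continuous_map_box_uc:
  assumes g: "box_uc d c c' g" and K: "K \<subseteq> tensors c d" "K \<subseteq> tensor_box c d r"
    and gT: "\<And>x. g x \<in> tensors c' d"
  shows "continuous_map (subtopology (mtopology_of (tensor_metric c d)) K)
    (mtopology_of (tensor_metric c' d)) (restrict g K)"
proof -
  have "uniformly_continuous_map (submetric (tensor_metric c d) K) (tensor_metric c' d) (restrict g K)"
    unfolding uniformly_continuous_map_def
  proof (intro conjI allI impI)
    show "restrict g K \<in> mspace (submetric (tensor_metric c d) K) \<rightarrow> mspace (tensor_metric c' d)"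
      using K gT by auto
    fix e :: real assume e: "0 < e"
    obtain \<delta> where \<delta>: "0 < \<delta>"
      "\<And>x y. x \<in> tensor_box c d r \<Longrightarrow> y \<in> tensor_box c d r \<Longrightarrow> near c d \<delta> x y \<Longrightarrow> near c' d (e / 2) (g x) (g y)"
      using box_ucE[OF g, of "e / 2" r] e by auto
    have "tensor_dist c' d (g y) (g x) < e" if "x \<in> K" "y \<in> K" "tensor_dist c d y x < \<delta>" for x y
    proof -
      have "near c d \<delta> y x"
        unfolding near_def using tensor_dist_ge[of _ c _ d y x] that(3) by force
      then have "near c' d (e / 2) (g y) (g x)"
        using that K by (intro \<delta>(2)) auto
      then have "tensor_dist c' d (g y) (g x) \<le> e / 2"
        unfolding tensor_dist_le_iff near_def using e by (auto intro: less_imp_le)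
      then show ?thesis using e by simp
    qed
    then show "\<exists>\<delta>>0. \<forall>x\<in>mspace (submetric (tensor_metric c d) K).
        \<forall>y\<in>mspace (submetric (tensor_metric c d) K). mdist (submetric (tensor_metric c d) K) y x < \<delta> \<longrightarrow>
          mdist (tensor_metric c' d) (restrict g K y) (restrict g K x) < e"
      using \<delta>(1) by (intro exI[of _ \<delta>]) auto
  qed
  then show ?thesis
    using uniformly_continuous_imp_continuous_map by (fastforce simp: mtopology_of_submetric)
qed

theorem theorem2:
  fixes d c\<^sub>1 c\<^sub>2 k :: nat and K :: "tensor set" and \<sigma> :: "real \<Rightarrow> real" and \<alpha> \<epsilon> :: real
  assumes "1 \<le> d" and "1 \<le> c\<^sub>1" and "1 \<le> c\<^sub>2"
    and "compactin (mtopology_of (tensor_metric c\<^sub>1 d)) K"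
    and "3 \<le> 2 * k + 1"
    and "continuous_on UNIV \<sigma>"
    and "\<not> (\<exists>a b. \<forall>t. \<sigma> t = a * t + b)"
    and "0 < \<epsilon>"
    and "\<sigma> C1_differentiable_on {\<alpha> - \<epsilon><..<\<alpha> + \<epsilon>}"
    and "deriv \<sigma> \<alpha> \<noteq> 0"
  shows "mtopology_of (unif_metric d c\<^sub>1 c\<^sub>2 K) closure_of
      ((\<lambda>f. restrict f K) ` deep_narrow_cnns \<sigma> d k c\<^sub>1 c\<^sub>2 (c\<^sub>1 + c\<^sub>2 + 2))
    = cont_funs d c\<^sub>1 c\<^sub>2 K"
proof -
  have "\<sigma> differentiable at \<alpha>"
    using assms(8,9) by (simp add: C1_differentiable_on_eq)
  then have "(\<sigma> has_real_derivative deriv \<sigma> \<alpha>) (at \<alpha>)"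
    by (simp add: DERIV_deriv_iff_real_differentiable)
  then interpret activation \<sigma> \<alpha> "deriv \<sigma> \<alpha>"
    using assms(6,10) by unfold_locales
  define X where "X = subtopology (mtopology_of (tensor_metric c\<^sub>1 d)) K"
  define M where "M = unif_metric d c\<^sub>1 c\<^sub>2 K"
  have K: "K \<subseteq> tensors c\<^sub>1 d"
    using compactin_subset_topspace[OF assms(4)] by simp
  have X: "topspace X = K"
    using K by (auto simp: X_def)
  have M: "mspace M = cont_funs d c\<^sub>1 c\<^sub>2 K"
    unfolding M_def by (rule mspace_unif_metric[OF assms(4)])
  obtain r where r: "\<And>x i m. x \<in> K \<Longrightarrow> i \<in> {1..c\<^sub>1} \<Longrightarrow> m \<in> {1..d} \<Longrightarrow> \<bar>x i m\<bar> \<le> r"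
    using compact_tensors_bounded[OF compact_tensors[OF assms(4)]] by metis
  then have Kr: "K \<subseteq> tensor_box c\<^sub>1 d r"
    by (auto simp: tensor_box_def)
  have approx: "\<exists>g\<in>deep_narrow_cnns \<sigma> d k c\<^sub>1 c\<^sub>2 (c\<^sub>1 + c\<^sub>2 + 2).
      restrict g K \<in> mspace M \<and> mdist M f (restrict g K) \<le> e"
    if f: "f \<in> cont_funs d c\<^sub>1 c\<^sub>2 K" and e: "0 < e" for f e
  proof -
    have "continuous_map X (mtopology_of (tensor_metric c\<^sub>2 d)) f"
      using f by (simp add: cont_funs_def X_def)
    from continuous_map_compose[OF this continuous_map_tensor_entry]
    have entry: "continuous_map X euclideanreal (\<lambda>x. f x j m)" for j m
      by (simp add: o_def)
    \<comment> \<open>One ridge sum per output entry; indices outside the ranges are covered too,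
      since such entries are constant functions.\<close>
    have "\<exists>h\<in>ridge_sums \<sigma> c\<^sub>1 d. \<forall>x\<in>K. \<bar>f x j m - h x\<bar> < e / 2" for j m
      by (rule ridge_sums_dense[OF exp_approximable[OF assms(6,7)] assms(4) entry[unfolded X_def]])
        (use e in simp)
    then obtain h where h: "\<And>j m. h j m \<in> ridge_sums \<sigma> c\<^sub>1 d"
      "\<And>j m x. x \<in> K \<Longrightarrow> \<bar>f x j m - h j m x\<bar> < e / 2"
      by metis
    have k: "1 \<le> k" and half: "0 < e / 2" using assms(5) e by simp_all
    obtain g where g: "g \<in> deep_narrow_cnns \<sigma> d k c\<^sub>1 c\<^sub>2 (c\<^sub>1 + c\<^sub>2 + 2)" "box_uc d c\<^sub>1 c\<^sub>2 g"
      "\<And>x. g x \<in> tensors c\<^sub>2 d"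
      "\<And>x j m. x \<in> tensor_box c\<^sub>1 d r \<Longrightarrow> j \<in> {1..c\<^sub>2} \<Longrightarrow> m \<in> {1..d} \<Longrightarrow> \<bar>g x j m - h j m x\<bar> < e / 2"
      using ridge_sum_cnn[where f = h and c' = c\<^sub>2 and r = r, OF k assms(2) half h(1)] by blast
    have "restrict g K \<in> mspace M"
      using continuous_map_box_uc[OF g(2) K Kr g(3)] unfolding M by (simp add: cont_funs_def)
    moreover have "mdist M f (restrict g K) \<le> e"
      unfolding M_def unif_metric_def X_def[symmetric]
    proof (rule mdist_cfunspace_le)
      fix x assume "x \<in> topspace X"
      then have x: "x \<in> K" "x \<in> tensor_box c\<^sub>1 d r" using X Kr by auto
      have "\<bar>f x j m - g x j m\<bar> \<le> e" if "j \<in> {1..c\<^sub>2}" "m \<in> {1..d}" for j m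
        using h(2)[OF x(1), of j m] g(4)[OF x(2) that] by linarith
      then show "mdist (tensor_metric c\<^sub>2 d) (f x) (restrict g K x) \<le> e"
        using x e by (simp add: tensor_dist_le_iff)
    qed (use e in simp)
    ultimately show ?thesis
      using g(1) by blast
  qed
  interpret M: Metric_space "mspace M" "mdist M"
    by (rule Metric_space_mspace_mdist)
  \<comment> \<open>The closure is described by closed balls, matching the non-strict bound in
    \<open>approx\<close>.\<close>
  have "\<exists>y\<in>(\<lambda>f. restrict f K) ` deep_narrow_cnns \<sigma> d k c\<^sub>1 c\<^sub>2 (c\<^sub>1 + c\<^sub>2 + 2). y \<in> M.mcball f e"
    if f: "f \<in> mspace M" and e: "0 < e" for f e
  proof -
    obtain g where "g \<in> deep_narrow_cnns \<sigma> d k c\<^sub>1 c\<^sub>2 (c\<^sub>1 + c\<^sub>2 + 2)"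
      "restrict g K \<in> mspace M" "mdist M f (restrict g K) \<le> e"
      using approx[OF f[unfolded M] e] by blast
    then show ?thesis
      using f by (intro bexI[of _ "restrict g K"]) auto
  qed
  then have "M.mtopology closure_of
      ((\<lambda>f. restrict f K) ` deep_narrow_cnns \<sigma> d k c\<^sub>1 c\<^sub>2 (c\<^sub>1 + c\<^sub>2 + 2)) = mspace M"
    unfolding M.metric_closure_of_alt by blast
  then have "mtopology_of M closure_of
      ((\<lambda>f. restrict f K) ` deep_narrow_cnns \<sigma> d k c\<^sub>1 c\<^sub>2 (c\<^sub>1 + c\<^sub>2 + 2)) = cont_funs d c\<^sub>1 c\<^sub>2 K"
    unfolding mtopology_of_def M .
  then show ?thesis
    unfolding M_def .
qed

end
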